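(* For $k\in\mathbb N=\{1,2,\ldots\}$ and $\xi>0$ let $p_k(\xi):=\mathrm P(V_k=0\mid V_0=0)$ and $r_k(\xi):=\mathrm P(R=k\mid V_0=0)$, where $R:=\inf\{k\in\mathbb N:V_k=0\}$. Then, for every $k\in\mathbb N$, $$r_k(\xi)=p_k(\xi)-\sum_{\ell=1}^{k-1}r_\ell(\xi)\,p_{k-\ell}(\xi),$$ where the empty sum is defined as $0$.
   Context: $J(\cdot)$ is a non-decreasing pure-jump Lévy process (driftless subordinator) with Lévy measure $\nu$ on $(0,\infty)$, and $X(t)=J(t)-t$. The workload process is $V(t)=X(t)+\max\{V(0),L(t)\}$ with $L(t):=-\inf_{0\le s\le t}X(s)$. It is sampled at the epochs $S_k=T_1+\cdots+T_k$ of an independent Poisson process of rate $\xi$ (the $T_i$ are i.i.d. exponential with mean $1/\xi$, independent of $J$ and $V(0)$); $V_k:=V(S_k)$, $V_0:=V(0)$. *)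

theory Defs
  imports "HOL-Probability.Probability"
begin

text \<open>Time is modelled by \<open>real\<close>; only the values at times \<open>t \<ge> 0\<close> are ever constrained or used.\<close>

definition cadlag :: "(real \<Rightarrow> real) \<Rightarrow> bool" where
  "cadlag f \<longleftrightarrow>
     (\<forall>t\<ge>0. continuous (at_right t) f) \<and> (\<forall>t>0. \<exists>l. (f \<longlongrightarrow> l) (at_left t))"

definition jump :: "(real \<Rightarrow> real) \<Rightarrow> real \<Rightarrow> real" where
  "jump f t = f t - Lim (at_left t) f"

text \<open>The path properties are required for every outcome rather than almost surely. Since \<open>M\<close> need
  not be complete, this is what makes the events below measurable.\<close>

locale levy_process = prob_space M for M :: "'a measure" +
  fixes J :: "real \<Rightarrow> 'a \<Rightarrow> real"
  assumes levy_measurable: "\<And>t. 0 \<le> t \<Longrightarrow> J t \<in> borel_measurable M"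
    and levy_start: "\<And>\<omega>. \<omega> \<in> space M \<Longrightarrow> J 0 \<omega> = 0"
    and levy_cadlag: "\<And>\<omega>. \<omega> \<in> space M \<Longrightarrow> cadlag (\<lambda>t. J t \<omega>)"
    and levy_indep_increments:
      "\<And>t :: nat \<Rightarrow> real. 0 \<le> t 0 \<Longrightarrow> mono t \<Longrightarrow>
         indep_vars (\<lambda>_. borel) (\<lambda>i \<omega>. J (t (Suc i)) \<omega> - J (t i) \<omega>) UNIV"
    and levy_stationary_increments:
      "\<And>s t. 0 \<le> s \<Longrightarrow> 0 \<le> t \<Longrightarrow>
         distr M borel (\<lambda>\<omega>. J (s + t) \<omega> - J s \<omega>) = distr M borel (J t)"

text \<open>A driftless subordinator is a nondecreasing Levy process that equals the sum of its jumps.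
  Its Levy measure assigns to \<open>B\<close> the expected number of jumps with size in \<open>B\<close> during a unit
  of time. The integrability of \<open>min 1 x\<close> with respect to this measure is a consequence.\<close>

locale driftless_subordinator = levy_process M J
  for M :: "'a measure" and J :: "real \<Rightarrow> 'a \<Rightarrow> real" +
  fixes \<nu> :: "real measure"
  assumes nondecreasing: "\<And>\<omega>. \<omega> \<in> space M \<Longrightarrow> mono_on {0..} (\<lambda>t. J t \<omega>)"
    and pure_jump:
      "\<And>\<omega> t. \<omega> \<in> space M \<Longrightarrow> 0 \<le> t \<Longrightarrow> (jump (\<lambda>s. J s \<omega>) has_sum J t \<omega>) {0<..t}"
    and sets_levy_measure: "sets \<nu> = sets (restrict_space borel {0<..})"
    and emeasure_levy_measure:
      "\<And>B. B \<in> sets \<nu> \<Longrightarrow>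
         emeasure \<nu> B =
           (\<integral>\<^sup>+ \<omega>. emeasure (count_space UNIV) {s \<in> {0<..1}. jump (\<lambda>u. J u \<omega>) s \<in> B} \<partial>M)"

definition net_input :: "(real \<Rightarrow> 'a \<Rightarrow> real) \<Rightarrow> real \<Rightarrow> 'a \<Rightarrow> real" where
  "net_input J t \<omega> = J t \<omega> - t"

definition regulator :: "(real \<Rightarrow> 'a \<Rightarrow> real) \<Rightarrow> real \<Rightarrow> 'a \<Rightarrow> real" where
  "regulator J t \<omega> = - (INF s\<in>{0..t}. net_input J s \<omega>)"

definition workload :: "(real \<Rightarrow> 'a \<Rightarrow> real) \<Rightarrow> ('a \<Rightarrow> real) \<Rightarrow> real \<Rightarrow> 'a \<Rightarrow> real" where
  "workload J V0 t \<omega> = net_input J t \<omega> + max (V0 \<omega>) (regulator J t \<omega>)"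

text \<open>Interarrival times are indexed from \<open>1\<close>; \<open>T 0\<close> is never used.\<close>

definition epoch :: "(nat \<Rightarrow> 'a \<Rightarrow> real) \<Rightarrow> nat \<Rightarrow> 'a \<Rightarrow> real" where
  "epoch T k \<omega> = (\<Sum>i=1..k. T i \<omega>)"

definition sampled_workload ::
    "(real \<Rightarrow> 'a \<Rightarrow> real) \<Rightarrow> ('a \<Rightarrow> real) \<Rightarrow> (nat \<Rightarrow> 'a \<Rightarrow> real) \<Rightarrow> nat \<Rightarrow> 'a \<Rightarrow> real" where
  "sampled_workload J V0 T k \<omega> = workload J V0 (epoch T k \<omega>) \<omega>"

text \<open>The infimum is taken in \<open>enat\<close>, so it is \<open>\<infinity>\<close> if no sampled workload vanishes.\<close>

definition return_index ::
    "(real \<Rightarrow> 'a \<Rightarrow> real) \<Rightarrow> ('a \<Rightarrow> real) \<Rightarrow> (nat \<Rightarrow> 'a \<Rightarrow> real) \<Rightarrow> 'a \<Rightarrow> enat" where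
  "return_index J V0 T \<omega> = Inf (enat ` {k. 1 \<le> k \<and> sampled_workload J V0 T k \<omega> = 0})"

text \<open>Unlike \<open>prob_space.indep_var\<close>, the two random elements may have values of different types.\<close>

definition indep_elements ::
    "'a measure \<Rightarrow> 'b measure \<Rightarrow> ('a \<Rightarrow> 'b) \<Rightarrow> 'c measure \<Rightarrow> ('a \<Rightarrow> 'c) \<Rightarrow> bool" where
  "indep_elements M A X B Y \<longleftrightarrow>
     X \<in> measurable M A \<and> Y \<in> measurable M B \<and>
     prob_space.indep_set M
       (sets (vimage_algebra (space M) X A)) (sets (vimage_algebra (space M) Y B))"

text \<open>The last two independence assumptions together say that \<open>J\<close> (as a process), \<open>V0\<close> and the
  sequence \<open>T\<close> are mutually independent.\<close>

locale poisson_sampled_queue = driftless_subordinator M J \<nu>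
  for M :: "'a measure" and J :: "real \<Rightarrow> 'a \<Rightarrow> real" and \<nu> :: "real measure" +
  fixes V0 :: "'a \<Rightarrow> real" and T :: "nat \<Rightarrow> 'a \<Rightarrow> real" and \<xi> :: real
  assumes rate_pos: "0 < \<xi>"
    and V0_nonneg: "\<And>\<omega>. \<omega> \<in> space M \<Longrightarrow> 0 \<le> V0 \<omega>"
    and T_nonneg: "\<And>i \<omega>. 1 \<le> i \<Longrightarrow> \<omega> \<in> space M \<Longrightarrow> 0 \<le> T i \<omega>"
    and T_exponential:
      "\<And>i. 1 \<le> i \<Longrightarrow> distributed M lborel (T i) (exponential_density \<xi>)"
    and T_indep: "indep_vars (\<lambda>_. borel) T {1..}"
    and J_V0_indep:
      "indep_elements M (\<Pi>\<^sub>M t\<in>{0..}. borel) (\<lambda>\<omega>. \<lambda>t\<in>{0..}. J t \<omega>) borel V0"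
    and J_V0_T_indep:
      "indep_elements M
         ((\<Pi>\<^sub>M t\<in>{0..}. borel) \<Otimes>\<^sub>M borel) (\<lambda>\<omega>. (\<lambda>t\<in>{0..}. J t \<omega>, V0 \<omega>))
         (\<Pi>\<^sub>M i\<in>{1..}. borel) (\<lambda>\<omega>. \<lambda>i\<in>{1..}. T i \<omega>)"

definition empty_prob ::
    "'a measure \<Rightarrow> (real \<Rightarrow> 'a \<Rightarrow> real) \<Rightarrow> ('a \<Rightarrow> real) \<Rightarrow> (nat \<Rightarrow> 'a \<Rightarrow> real) \<Rightarrow> nat \<Rightarrow> real" where
  "empty_prob M J V0 T k =
     \<P>(\<omega> in M. sampled_workload J V0 T k \<omega> = 0 \<bar> sampled_workload J V0 T 0 \<omega> = 0)"

definition return_prob ::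
    "'a measure \<Rightarrow> (real \<Rightarrow> 'a \<Rightarrow> real) \<Rightarrow> ('a \<Rightarrow> real) \<Rightarrow> (nat \<Rightarrow> 'a \<Rightarrow> real) \<Rightarrow> nat \<Rightarrow> real" where
  "return_prob M J V0 T k =
     \<P>(\<omega> in M. return_index J V0 T \<omega> = enat k \<bar> sampled_workload J V0 T 0 \<omega> = 0)"

end

theory Submission
  imports Defs
begin

text \<open>Started at an empty queue, the workload at \<open>S\<^sub>k\<close> vanishes iff \<open>X\<close> attains its minimum over
  \<open>[0, S\<^sub>k]\<close> at \<open>S\<^sub>k\<close>. If it also vanishes at \<open>S\<^sub>l\<close>, then its vanishing at \<open>S\<^sub>k\<close> only depends on the
  increments of \<open>J\<close> after \<open>S\<^sub>l\<close>. Conditionally on the epochs (Fubini, as \<open>J\<close> and \<open>T\<close> are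
  independent), these increments are independent of the past and distributed as \<open>J\<close>; and
  \<open>S\<^sub>k - S\<^sub>l\<close> is independent of \<open>S\<^sub>1, \<dots>, S\<^sub>l\<close> and distributed as \<open>S\<^bsub>k-l\<^esub>\<close>. So \<open>R = l\<close> and \<open>V\<^sub>k = 0\<close> hold
  together with probability \<open>r\<^sub>l p\<^bsub>k-l\<^esub>\<close>, and summing over \<open>l \<le> k\<close> gives \<open>p\<^sub>k\<close>.\<close>

section \<open>Independent random elements\<close>

text \<open>Independence is the product formula on measurable rectangles, and these determine the
  measure on the product.\<close>

lemma (in prob_space) distr_pair_eq_of_indep_elements:
  assumes "indep_elements M A X B Y"
  shows "distr M (A \<Otimes>\<^sub>M B) (\<lambda>\<omega>. (X \<omega>, Y \<omega>)) = distr M A X \<Otimes>\<^sub>M distr M B Y"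
proof -
  have X[measurable]: "X \<in> measurable M A" and Y[measurable]: "Y \<in> measurable M B"
    and indep: "indep_set (sets (vimage_algebra (space M) X A)) (sets (vimage_algebra (space M) Y B))"
    using assms by (auto simp: indep_elements_def)
  interpret X: prob_space "distr M A X" by (rule prob_space_distr) fact
  interpret Y: prob_space "distr M B Y" by (rule prob_space_distr) fact
  show ?thesis
  proof (rule pair_measure_eqI[symmetric])
    fix C D assume "C \<in> sets (distr M A X)" "D \<in> sets (distr M B Y)"
    then have [measurable]: "C \<in> sets A" "D \<in> sets B" by auto
    have "prob ((X -` C \<inter> space M) \<inter> (Y -` D \<inter> space M)) =
        prob (X -` C \<inter> space M) * prob (Y -` D \<inter> space M)"
      by (rule indep_setD[OF indep]) (auto intro: in_vimage_algebra)
    moreover have "(\<lambda>\<omega>. (X \<omega>, Y \<omega>)) -` (C \<times> D) \<inter> space M = (X -` C \<inter> space M) \<inter> (Y -` D \<inter> space M)"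
      by auto
    ultimately show "emeasure (distr M A X) C * emeasure (distr M B Y) D =
        emeasure (distr M (A \<Otimes>\<^sub>M B) (\<lambda>\<omega>. (X \<omega>, Y \<omega>))) (C \<times> D)"
      by (simp add: emeasure_distr emeasure_eq_measure ennreal_mult)
  qed (unfold_locales, simp cong: sets_pair_measure_cong)
qed

lemma (in prob_space) prob_indep_elements_eq_integral:
  assumes indep: "indep_elements M A X B Y"
    and Q[measurable]: "Measurable.pred (A \<Otimes>\<^sub>M B) (\<lambda>(x, y). Q x y)"
  shows "\<P>(\<omega> in M. Q (X \<omega>) (Y \<omega>)) = (\<integral>\<omega>'. \<P>(\<omega> in M. Q (X \<omega>) (Y \<omega>')) \<partial>M)"
proof -
  have X[measurable]: "X \<in> measurable M A" and Y[measurable]: "Y \<in> measurable M B"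
    using indep by (auto simp: indep_elements_def)
  interpret X: prob_space "distr M A X" by (rule prob_space_distr) fact
  interpret Y: prob_space "distr M B Y" by (rule prob_space_distr) fact
  interpret XY: pair_prob_space "distr M A X" "distr M B Y" ..
  let ?C = "{z \<in> space (A \<Otimes>\<^sub>M B). Q (fst z) (snd z)}"
  have C[measurable]: "?C \<in> sets (A \<Otimes>\<^sub>M B)"
    using Q by (simp add: case_prod_unfold pred_def)
  have "Measurable.pred (M \<Otimes>\<^sub>M M) (\<lambda>z. (\<lambda>(x, y). Q x y) (X (snd z), Y (fst z)))"
    by measurable
  then have QM: "Measurable.pred (M \<Otimes>\<^sub>M M) (\<lambda>z. Q (X (snd z)) (Y (fst z)))"
    by simp
  have meas: "(\<lambda>\<omega>'. \<P>(\<omega> in M. Q (X \<omega>) (Y \<omega>'))) \<in> borel_measurable M"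
  proof (rule measurable_measure)
    have "{x \<in> space (M \<Otimes>\<^sub>M M). snd x \<in> {\<omega> \<in> space M. Q (X \<omega>) (Y (fst x))}} =
        {x \<in> space (M \<Otimes>\<^sub>M M). Q (X (snd x)) (Y (fst x))}"
      by (auto simp: space_pair_measure)
    then show "{x \<in> space (M \<Otimes>\<^sub>M M). snd x \<in> {\<omega> \<in> space M. Q (X \<omega>) (Y (fst x))}} \<in> sets (M \<Otimes>\<^sub>M M)"
      using QM by (simp add: pred_def)
  qed auto
  have slice: "emeasure (distr M A X) ((\<lambda>x. (x, Y \<omega>')) -` ?C) = ennreal (\<P>(\<omega> in M. Q (X \<omega>) (Y \<omega>')))"
    if "\<omega>' \<in> space M" for \<omega>'
  proof -
    have Y': "Y \<omega>' \<in> space B" using measurable_space[OF Y that] .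
    have "emeasure (distr M A X) ((\<lambda>x. (x, Y \<omega>')) -` ?C) =
        emeasure M (X -` ((\<lambda>x. (x, Y \<omega>')) -` ?C) \<inter> space M)"
      by (rule emeasure_distr[OF X]) (rule sets_Pair2[OF C])
    also have "X -` ((\<lambda>x. (x, Y \<omega>')) -` ?C) \<inter> space M = {\<omega> \<in> space M. Q (X \<omega>) (Y \<omega>')}"
      using Y' measurable_space[OF X] by (auto simp: space_pair_measure)
    finally show ?thesis by (simp add: emeasure_eq_measure)
  qed
  have "ennreal (\<P>(\<omega> in M. Q (X \<omega>) (Y \<omega>))) = emeasure (distr M (A \<Otimes>\<^sub>M B) (\<lambda>\<omega>. (X \<omega>, Y \<omega>))) ?C"
    using measurable_space[OF X] measurable_space[OF Y]
    by (subst emeasure_distr)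
      (auto simp: emeasure_eq_measure space_pair_measure intro!: arg_cong[where f=prob])
  also have "\<dots> = (\<integral>\<^sup>+y. emeasure (distr M A X) ((\<lambda>x. (x, y)) -` ?C) \<partial>distr M B Y)"
    unfolding distr_pair_eq_of_indep_elements[OF indep]
    by (rule XY.emeasure_pair_measure_alt2) (simp cong: sets_pair_measure_cong)
  also have "\<dots> = (\<integral>\<^sup>+\<omega>'. emeasure (distr M A X) ((\<lambda>x. (x, Y \<omega>')) -` ?C) \<partial>M)"
  proof (rule nn_integral_distr[OF Y])
    have "?C \<in> sets (distr M A X \<Otimes>\<^sub>M distr M B Y)" by (simp cong: sets_pair_measure_cong)
    from XY.measurable_emeasure_Pair2[OF this]
    show "(\<lambda>y. emeasure (distr M A X) ((\<lambda>x. (x, y)) -` ?C)) \<in> borel_measurable (distr M B Y)" .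
  qed
  also have "\<dots> = (\<integral>\<^sup>+\<omega>'. ennreal (\<P>(\<omega> in M. Q (X \<omega>) (Y \<omega>'))) \<partial>M)"
    by (rule nn_integral_cong) (rule slice)
  also have "\<dots> = ennreal (\<integral>\<omega>'. \<P>(\<omega> in M. Q (X \<omega>) (Y \<omega>')) \<partial>M)"
    using meas by (intro nn_integral_eq_integral integrable_const_bound[where B=1]) auto
  finally show "\<P>(\<omega> in M. Q (X \<omega>) (Y \<omega>)) = (\<integral>\<omega>'. \<P>(\<omega> in M. Q (X \<omega>) (Y \<omega>')) \<partial>M)"
    by (simp add: integral_nonneg)
qed

lemma (in prob_space) indep_elements_prob_conj:
  assumes indep: "indep_elements M A X B Y"
    and P: "Measurable.pred A P" and Q: "Measurable.pred B Q"
  shows "\<P>(\<omega> in M. P (X \<omega>) \<and> Q (Y \<omega>)) = \<P>(\<omega> in M. P (X \<omega>)) * \<P>(\<omega> in M. Q (Y \<omega>))"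
proof -
  have X: "X \<in> measurable M A" and Y: "Y \<in> measurable M B"
    and ind: "indep_set (sets (vimage_algebra (space M) X A)) (sets (vimage_algebra (space M) Y B))"
    using indep by (auto simp: indep_elements_def)
  have eq: "{\<omega> \<in> space M. P (X \<omega>)} = X -` {x \<in> space A. P x} \<inter> space M"
    "{\<omega> \<in> space M. Q (Y \<omega>)} = Y -` {y \<in> space B. Q y} \<inter> space M"
    "{\<omega> \<in> space M. P (X \<omega>) \<and> Q (Y \<omega>)} =
      (X -` {x \<in> space A. P x} \<inter> space M) \<inter> (Y -` {y \<in> space B. Q y} \<inter> space M)"
    using measurable_space[OF X] measurable_space[OF Y] by auto
  show ?thesis
    unfolding eq using P Q by (intro indep_setD[OF ind] in_vimage_algebra) (auto simp: pred_def)
qed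

text \<open>The finite-dimensional cylinders generate the product \<sigma>-algebra and are stable
  under intersection. So do their preimages for the pulled-back \<sigma>-algebras, and a Dynkin
  argument extends independence from the cylinders.\<close>

lemma (in prob_space) indep_elements_PiM:
  assumes X[measurable]: "\<And>u. u \<in> I \<Longrightarrow> X u \<in> measurable M (N u)"
    and Y[measurable]: "\<And>u. u \<in> K \<Longrightarrow> Y u \<in> measurable M (L u)"
    and cyl: "\<And>F G A B. finite F \<Longrightarrow> F \<subseteq> I \<Longrightarrow> finite G \<Longrightarrow> G \<subseteq> K \<Longrightarrow>
      (\<And>u. u \<in> F \<Longrightarrow> A u \<in> sets (N u)) \<Longrightarrow> (\<And>u. u \<in> G \<Longrightarrow> B u \<in> sets (L u)) \<Longrightarrow>
      \<P>(\<omega> in M. (\<forall>u\<in>F. X u \<omega> \<in> A u) \<and> (\<forall>u\<in>G. Y u \<omega> \<in> B u)) =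
      \<P>(\<omega> in M. \<forall>u\<in>F. X u \<omega> \<in> A u) * \<P>(\<omega> in M. \<forall>u\<in>G. Y u \<omega> \<in> B u)"
  shows "indep_elements M (PiM I N) (\<lambda>\<omega>. \<lambda>u\<in>I. X u \<omega>) (PiM K L) (\<lambda>\<omega>. \<lambda>u\<in>K. Y u \<omega>)"
proof -
  let ?X = "\<lambda>\<omega>. \<lambda>u\<in>I. X u \<omega>" and ?Y = "\<lambda>\<omega>. \<lambda>u\<in>K. Y u \<omega>"
  have mX: "?X \<in> measurable M (PiM I N)" and mY: "?Y \<in> measurable M (PiM K L)"
    by (auto intro!: measurable_restrict X Y)
  have gen: "sets (vimage_algebra (space M) Z (PiM I' N')) =
      sigma_sets (space M) {Z -` a \<inter> space M |a. a \<in> prod_algebra I' N'}"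
    if "Z \<in> measurable M (PiM I' N')" for Z :: "'a \<Rightarrow> 'i \<Rightarrow> 'j" and I' N'
  proof -
    have Z: "Z \<in> space M \<rightarrow> space (PiM I' N')"
      using measurable_space[OF that] by auto
    show ?thesis
      using Z by (subst sets_vimage_algebra2[OF Z], subst sets_PiM)
        (rule sigma_sets_vimage_commute, simp add: space_PiM)
  qed
  have stable: "Int_stable {Z -` a \<inter> space M |a. a \<in> prod_algebra I' N'}"
    for Z :: "'a \<Rightarrow> 'i \<Rightarrow> 'j" and I' N'
  proof (rule Int_stableI)
    fix a b assume "a \<in> {Z -` a \<inter> space M |a. a \<in> prod_algebra I' N'}" "b \<in> {Z -` a \<inter> space M |a. a \<in> prod_algebra I' N'}"
    then obtain a' b' where "a = Z -` a' \<inter> space M" "b = Z -` b' \<inter> space M"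
      "a' \<in> prod_algebra I' N'" "b' \<in> prod_algebra I' N'" by auto
    moreover from this have "a' \<inter> b' \<in> prod_algebra I' N'"
      using Int_stable_prod_algebra[of I' N'] by (auto simp: Int_stable_def)
    ultimately show "a \<inter> b \<in> {Z -` a \<inter> space M |a. a \<in> prod_algebra I' N'}"
      by (auto intro!: exI[of _ "a' \<inter> b'"])
  qed
  have "indep_set {?X -` a \<inter> space M |a. a \<in> prod_algebra I N} {?Y -` b \<inter> space M |b. b \<in> prod_algebra K L}"
  proof (rule indep_setI)
    show "{?X -` a \<inter> space M |a. a \<in> prod_algebra I N} \<subseteq> events"
      using measurable_sets[OF mX] by (auto simp: sets_PiM)
    show "{?Y -` b \<inter> space M |b. b \<in> prod_algebra K L} \<subseteq> events"
      using measurable_sets[OF mY] by (auto simp: sets_PiM)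
  next
    fix a b assume "a \<in> {?X -` a \<inter> space M |a. a \<in> prod_algebra I N}"
      "b \<in> {?Y -` b \<inter> space M |b. b \<in> prod_algebra K L}"
    then obtain a' b' where a: "a = ?X -` a' \<inter> space M" "a' \<in> prod_algebra I N"
      and b: "b = ?Y -` b' \<inter> space M" "b' \<in> prod_algebra K L" by auto
    obtain F A where F: "a' = prod_emb I N F (Pi\<^sub>E F A)" "finite F" "F \<subseteq> I" "\<And>u. u \<in> F \<Longrightarrow> A u \<in> sets (N u)"
      using a(2) by (rule prod_algebraE) blast
    obtain G B where G: "b' = prod_emb K L G (Pi\<^sub>E G B)" "finite G" "G \<subseteq> K" "\<And>u. u \<in> G \<Longrightarrow> B u \<in> sets (L u)"
      using b(2) by (rule prod_algebraE) blast
    have "a = {\<omega> \<in> space M. \<forall>u\<in>F. X u \<omega> \<in> A u}"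
      using F measurable_space[OF X] by (fastforce simp: a prod_emb_def PiE_iff)
    moreover have "b = {\<omega> \<in> space M. \<forall>u\<in>G. Y u \<omega> \<in> B u}"
      using G measurable_space[OF Y] by (fastforce simp: b prod_emb_def PiE_iff)
    moreover from calculation have "a \<inter> b = {\<omega> \<in> space M. (\<forall>u\<in>F. X u \<omega> \<in> A u) \<and> (\<forall>u\<in>G. Y u \<omega> \<in> B u)}"
      by auto
    ultimately show "prob (a \<inter> b) = prob a * prob b"
      using cyl[of F G A B] F G by simp
  qed
  from indep_set_sigma_sets[OF this stable stable]
  show ?thesis
    using mX mY by (simp add: indep_elements_def gen)
qed

section \<open>The Markov property of a Levy process\<close>

text \<open>Independence of increments is given along infinite monotone sequences of times, so
  finitely many times have to be embedded in one. Starting it at 0 makes every value of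
  \<open>J\<close> on the grid a sum of increments.\<close>

lemma finite_subset_range_mono:
  fixes F :: "real set"
  assumes "finite F" "F \<subseteq> {0..}"
  obtains t :: "nat \<Rightarrow> real" where "mono t" "t 0 = 0" "F \<subseteq> range t"
proof
  define L where "L = sorted_list_of_set (insert 0 F)"
  have L: "sorted L" "set L = insert 0 F" "L \<noteq> []"
    using assms(1) unfolding L_def
    by (simp_all only: sorted_sorted_list_of_set set_sorted_list_of_set finite_insert
        sorted_list_of_set_eq_Nil_iff insert_not_empty not_False_eq_True)
  \<comment> \<open>Past the end of the sorted list the last entry is repeated; the increments there
    are trivial.\<close>
  define t where "t i = L ! min i (length L - 1)" for i
  show "mono t"
    using L unfolding t_def mono_def
    by (intro allI impI sorted_nth_mono) (auto simp: min_def Suc_le_eq[symmetric] neq_Nil_conv)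
  show "F \<subseteq> range t"
  proof
    fix u assume "u \<in> F"
    then obtain i where "i < length L" "L ! i = u"
      using L by (metis in_set_conv_nth insertI2)
    then show "u \<in> range t" by (auto simp: t_def min_def intro!: image_eqI[where x=i])
  qed
  obtain i where "i < length L" "L ! i = 0"
    using L by (metis in_set_conv_nth insertI1)
  then have "t 0 \<le> 0" using \<open>sorted L\<close> by (auto simp: t_def intro!: order.trans[OF sorted_nth_mono[of L 0 i]])
  moreover have "t 0 \<in> insert 0 F" using L unfolding t_def by (metis length_greater_0_conv min_0L nth_mem)
  ultimately show "t 0 = 0" using assms by auto
qed

lemma borel_measurable_sum_component:
  assumes "S \<subseteq> I"
  shows "(\<lambda>d. \<Sum>j\<in>S. d j :: real) \<in> borel_measurable (PiM I (\<lambda>_. borel))"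
proof (rule borel_measurable_sum)
  fix j assume "j \<in> S"
  then show "(\<lambda>d. d j) \<in> borel_measurable (PiM I (\<lambda>_. borel))"
    using assms by (intro measurable_component_singleton) auto
qed

context levy_process
begin

text \<open>All times are put on one monotone grid with \<open>s = t m\<close>. Values up to time
  \<open>s\<close> are sums of grid increments with index below \<open>m\<close>, and increments
  after \<open>s\<close> are sums of those with index at least \<open>m\<close>. These are disjoint
  blocks of an independent family.\<close>

lemma levy_indep_cylinders:
  assumes s: "0 \<le> s" and F: "finite F" "F \<subseteq> {0..s}" and G: "finite G" "G \<subseteq> {0..}"
    and A: "\<And>u. u \<in> F \<Longrightarrow> A u \<in> sets borel" and B: "\<And>u. u \<in> G \<Longrightarrow> B u \<in> sets borel"
  shows "\<P>(\<omega> in M. (\<forall>u\<in>F. J u \<omega> \<in> A u) \<and> (\<forall>u\<in>G. J (s + u) \<omega> - J s \<omega> \<in> B u)) =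
    \<P>(\<omega> in M. \<forall>u\<in>F. J u \<omega> \<in> A u) * \<P>(\<omega> in M. \<forall>u\<in>G. J (s + u) \<omega> - J s \<omega> \<in> B u)"
proof -
  have "finite (insert s (F \<union> (+) s ` G))" "insert s (F \<union> (+) s ` G) \<subseteq> {0..}"
    using s F G by auto
  then obtain t :: "nat \<Rightarrow> real" where t: "mono t" "t 0 = 0" "insert s (F \<union> (+) s ` G) \<subseteq> range t"
    by (rule finite_subset_range_mono)
  then obtain m where m: "t m = s" by auto
  define D where "D i \<omega> = J (t (Suc i)) \<omega> - J (t i) \<omega>" for i \<omega>
  have D: "indep_vars (\<lambda>_. borel) D UNIV"
    unfolding D_def[abs_def] using t by (intro levy_indep_increments) auto
  \<comment> \<open>The grid may take the value \<open>s\<close> at several indices. If the index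
    found for \<open>u\<close> exceeds \<open>m\<close>, then monotonicity forces
    \<open>u = s\<close>, and \<open>m\<close> itself serves. The same argument handles the indices
    for \<open>G\<close> below.\<close>
  have "\<exists>i\<le>m. t i = u" if "u \<in> F" for u
  proof -
    obtain i where i: "u = t i" using t \<open>u \<in> F\<close> by auto
    show ?thesis
    proof (cases "i \<le> m")
      case False
      then have "t m \<le> t i" using t by (intro monoD[OF t(1)]) auto
      then show ?thesis using F that m i by force
    qed (use i in auto)
  qed
  then obtain a where a: "\<And>u. u \<in> F \<Longrightarrow> a u \<le> m \<and> t (a u) = u" by metis
  have "\<exists>i\<ge>m. t i = s + u" if "u \<in> G" for u
  proof -
    obtain i where i: "s + u = t i" using t \<open>u \<in> G\<close> by blast
    show ?thesis
    proof (cases "m \<le> i")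
      case False
      then have "t i \<le> t m" using t by (intro monoD[OF t(1)]) auto
      then show ?thesis using G that m i by force
    qed (use i in auto)
  qed
  then obtain b where b: "\<And>u. u \<in> G \<Longrightarrow> m \<le> b u \<and> t (b u) = s + u" by metis
  have past: "J u \<omega> = (\<Sum>j<a u. D j \<omega>)" if "\<omega> \<in> space M" "u \<in> F" for u \<omega>
    using a[OF that(2)] t(2) levy_start[OF that(1)] sum_lessThan_telescope[of "\<lambda>j. J (t j) \<omega>" "a u"]
    by (simp add: D_def)
  have future: "J (s + u) \<omega> - J s \<omega> = (\<Sum>j=m..<b u. D j \<omega>)" if "\<omega> \<in> space M" "u \<in> G" for u \<omega>
    using b[OF that(2)] m sum_Suc_diff'[of m "b u" "\<lambda>j. J (t j) \<omega>"] by (simp add: D_def)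
  define P where "P = {d \<in> space (PiM {..<m} (\<lambda>_. borel :: real measure)). \<forall>u\<in>F. (\<Sum>j<a u. d j) \<in> A u}"
  define Q where "Q = {d \<in> space (PiM {m..} (\<lambda>_. borel :: real measure)). \<forall>u\<in>G. (\<Sum>j=m..<b u. d j) \<in> B u}"
  have P_sets: "P \<in> sets (PiM {..<m} (\<lambda>_. borel))"
  proof -
    have "(\<lambda>d. \<Sum>j<a u. d j :: real) \<in> borel_measurable (PiM {..<m} (\<lambda>_. borel))" if "u \<in> F" for u
      using a[OF that] by (intro borel_measurable_sum_component) auto
    then have "Measurable.pred (PiM {..<m} (\<lambda>_. borel)) (\<lambda>d. \<forall>u\<in>F. (\<Sum>j<a u. d j) \<in> A u)"
      using F(1) A by (intro pred_intros_finite pred_sets2[where N=borel]) auto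
    then show ?thesis by (simp add: pred_def P_def)
  qed
  have Q_sets: "Q \<in> sets (PiM {m..} (\<lambda>_. borel))"
  proof -
    have "(\<lambda>d. \<Sum>j=m..<b u. d j :: real) \<in> borel_measurable (PiM {m..} (\<lambda>_. borel))" if "u \<in> G" for u
      using b[OF that] by (intro borel_measurable_sum_component) auto
    then have "Measurable.pred (PiM {m..} (\<lambda>_. borel)) (\<lambda>d. \<forall>u\<in>G. (\<Sum>j=m..<b u. d j) \<in> B u)"
      using G(1) B by (intro pred_intros_finite pred_sets2[where N=borel]) auto
    then show ?thesis by (simp add: pred_def Q_def)
  qed
  let ?X = "\<lambda>\<omega>. restrict (\<lambda>i. D i \<omega>) {..<m}" and ?Y = "\<lambda>\<omega>. restrict (\<lambda>i. D i \<omega>) {m..}"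
  have "indep_var (PiM {..<m} (\<lambda>_. borel)) ?X (PiM {m..} (\<lambda>_. borel)) ?Y"
    by (rule indep_var_restrict[OF D]) auto
  note prod = indep_varD[OF this P_sets Q_sets]
  have P: "?X \<omega> \<in> P \<longleftrightarrow> (\<forall>u\<in>F. J u \<omega> \<in> A u)" if "\<omega> \<in> space M" for \<omega>
  proof -
    have "(\<Sum>j<a u. ?X \<omega> j) = J u \<omega>" if "u \<in> F" for u
      unfolding past[OF \<open>\<omega> \<in> space M\<close> that] using a[OF that] by (intro sum.cong) auto
    then show ?thesis by (auto simp: P_def space_PiM)
  qed
  have Q: "?Y \<omega> \<in> Q \<longleftrightarrow> (\<forall>u\<in>G. J (s + u) \<omega> - J s \<omega> \<in> B u)" if "\<omega> \<in> space M" for \<omega>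
  proof -
    have "(\<Sum>j=m..<b u. ?Y \<omega> j) = J (s + u) \<omega> - J s \<omega>" if "u \<in> G" for u
      unfolding future[OF \<open>\<omega> \<in> space M\<close> that] using b[OF that] by (intro sum.cong) auto
    then show ?thesis by (auto simp: Q_def space_PiM)
  qed
  have "?X -` P \<inter> space M = {\<omega> \<in> space M. \<forall>u\<in>F. J u \<omega> \<in> A u}"
    "?Y -` Q \<inter> space M = {\<omega> \<in> space M. \<forall>u\<in>G. J (s + u) \<omega> - J s \<omega> \<in> B u}"
    "(\<lambda>\<omega>. (?X \<omega>, ?Y \<omega>)) -` (P \<times> Q) \<inter> space M =
      {\<omega> \<in> space M. (\<forall>u\<in>F. J u \<omega> \<in> A u) \<and> (\<forall>u\<in>G. J (s + u) \<omega> - J s \<omega> \<in> B u)}"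
    using P Q by auto
  then show ?thesis using prod by simp
qed

text \<open>Along a grid shifted by \<open>s\<close> the increments are again independent, and by
  stationarity each has the law of the unshifted one. Hence the whole sequences of increments agree
  in law, and the cylinder events are read off from their partial sums.\<close>

lemma levy_shift_cylinder:
  assumes s: "0 \<le> s" and G: "finite G" "G \<subseteq> {0..}" and B: "\<And>u. u \<in> G \<Longrightarrow> B u \<in> sets borel"
  shows "\<P>(\<omega> in M. \<forall>u\<in>G. J (s + u) \<omega> - J s \<omega> \<in> B u) = \<P>(\<omega> in M. \<forall>u\<in>G. J u \<omega> \<in> B u)"
proof -
  obtain t :: "nat \<Rightarrow> real" where t: "mono t" "t 0 = 0" "G \<subseteq> range t"
    using G by (rule finite_subset_range_mono)
  then have "\<forall>u\<in>G. \<exists>i. t i = u" by fastforce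
  then obtain b where b: "\<And>u. u \<in> G \<Longrightarrow> t (b u) = u" by metis
  have t0: "0 \<le> t i" for i using monoD[OF t(1), of 0 i] t(2) by simp
  define D where "D s i \<omega> = J (s + t (Suc i)) \<omega> - J (s + t i) \<omega>" for s i \<omega>
  have meas[measurable]: "D s i \<in> borel_measurable M" if "0 \<le> s" for s i
    unfolding D_def[abs_def] using that t0 by (intro borel_measurable_diff levy_measurable) auto
  have indep: "indep_vars (\<lambda>_. borel) (D s) UNIV" if "0 \<le> s" for s
    unfolding D_def[abs_def] using t that
    by (intro levy_indep_increments[of "\<lambda>i. s + t i"]) (auto simp: mono_def)
  have law: "distr M borel (D s i) = distr M borel (J (t (Suc i) - t i))" if "0 \<le> s" for s i
    using levy_stationary_increments[of "s + t i" "t (Suc i) - t i"] that t0[of i] monoD[OF t(1), of i "Suc i"]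
    by (simp add: D_def[abs_def])
  \<comment> \<open>By independence both sides are products of their marginals, and by
    \<open>law\<close> these marginals do not depend on the shift.\<close>
  have eq: "distr M (\<Pi>\<^sub>M i\<in>UNIV. borel) (\<lambda>\<omega>. \<lambda>i\<in>UNIV. D s i \<omega>) =
      distr M (\<Pi>\<^sub>M i\<in>UNIV. borel) (\<lambda>\<omega>. \<lambda>i\<in>UNIV. D 0 i \<omega>)"
    using indep[OF s] indep[of 0] s by (simp add: indep_vars_iff_distr_eq_PiM meas law)
  define Q where "Q = {d \<in> space (PiM UNIV (\<lambda>_. borel :: real measure)). \<forall>u\<in>G. (\<Sum>j<b u. d j) \<in> B u}"
  have Q: "Q \<in> sets (\<Pi>\<^sub>M i\<in>UNIV. borel)"
  proof -
    have "(\<lambda>d. \<Sum>j<b u. d j :: real) \<in> borel_measurable (\<Pi>\<^sub>M i\<in>UNIV. borel)" for u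
      by (intro borel_measurable_sum_component) auto
    then have "Measurable.pred (\<Pi>\<^sub>M i\<in>UNIV. borel) (\<lambda>d. \<forall>u\<in>G. (\<Sum>j<b u. d j) \<in> B u)"
      using G(1) B by (intro pred_intros_finite pred_sets2[where N=borel]) auto
    then show ?thesis by (simp add: pred_def Q_def)
  qed
  have *: "measure (distr M (\<Pi>\<^sub>M i\<in>UNIV. borel) (\<lambda>\<omega>. \<lambda>i\<in>UNIV. D s i \<omega>)) Q =
      \<P>(\<omega> in M. \<forall>u\<in>G. J (s + u) \<omega> - J s \<omega> \<in> B u)" if "0 \<le> s" for s
  proof -
    have "(\<Sum>j<b u. D s j \<omega>) = J (s + u) \<omega> - J s \<omega>" if "u \<in> G" for u \<omega>
      using b[OF that] t(2) sum_lessThan_telescope[of "\<lambda>i. J (s + t i) \<omega>" "b u"] by (simp add: D_def)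
    then have "(\<lambda>\<omega>. \<lambda>i\<in>UNIV. D s i \<omega>) -` Q \<inter> space M =
        {\<omega> \<in> space M. \<forall>u\<in>G. J (s + u) \<omega> - J s \<omega> \<in> B u}"
      by (auto simp: space_PiM Q_def)
    then show ?thesis
      using that by (subst measure_distr) (auto intro!: Q measurable_restrict meas)
  qed
  have "\<P>(\<omega> in M. \<forall>u\<in>G. J (s + u) \<omega> - J s \<omega> \<in> B u) = \<P>(\<omega> in M. \<forall>u\<in>G. J (0 + u) \<omega> - J 0 \<omega> \<in> B u)"
    using eq *[of 0] *[OF s] by simp
  also have "\<dots> = \<P>(\<omega> in M. \<forall>u\<in>G. J u \<omega> \<in> B u)"
    by (intro arg_cong[where f=prob]) (auto simp: levy_start)
  finally show ?thesis .
qed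

text \<open>This is the Markov property at a deterministic time, for whole path segments. A
  deterministic time suffices because the epochs are frozen before it is applied.\<close>

lemma levy_markov:
  assumes s: "0 \<le> s"
  shows "indep_elements M (\<Pi>\<^sub>M u\<in>{0..s}. borel) (\<lambda>\<omega>. \<lambda>u\<in>{0..s}. J u \<omega>)
    (\<Pi>\<^sub>M u\<in>{0..}. borel) (\<lambda>\<omega>. \<lambda>u\<in>{0..}. J (s + u) \<omega> - J s \<omega>)"
  by (rule indep_elements_PiM; (rule levy_indep_cylinders)?)
    (use s in \<open>auto intro!: borel_measurable_diff levy_measurable\<close>)

lemma levy_shift_distr:
  assumes s: "0 \<le> s"
  shows "distr M (\<Pi>\<^sub>M u\<in>{0..}. borel) (\<lambda>\<omega>. \<lambda>u\<in>{0..}. J (s + u) \<omega> - J s \<omega>) =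
    distr M (\<Pi>\<^sub>M u\<in>{0..}. borel) (\<lambda>\<omega>. \<lambda>u\<in>{0..}. J u \<omega>)"
proof (rule measure_eqI_PiM_infinite[where I="{0..}" and M="\<lambda>_. borel"])
  have meas: "(\<lambda>\<omega>. \<lambda>u\<in>{0..}. J (s + u) \<omega> - J s \<omega>) \<in> measurable M (\<Pi>\<^sub>M u\<in>{0..}. borel)"
    "(\<lambda>\<omega>. \<lambda>u\<in>{0..}. J u \<omega>) \<in> measurable M (\<Pi>\<^sub>M u\<in>{0..}. borel)"
    using s by (auto intro!: measurable_restrict borel_measurable_diff levy_measurable)
  show "finite_measure (distr M (\<Pi>\<^sub>M u\<in>{0..}. borel) (\<lambda>\<omega>. \<lambda>u\<in>{0..}. J (s + u) \<omega> - J s \<omega>))"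
    by (rule finite_measure_distr) (rule meas)
  fix B and G :: "real set" assume G: "finite G" "G \<subseteq> {0..}" "\<And>u. u \<in> G \<Longrightarrow> B u \<in> sets (borel :: real measure)"
  have emb: "prod_emb {0..} (\<lambda>_. borel) G (Pi\<^sub>E G B) \<in> sets (PiM {0..} (\<lambda>_. borel))"
    using G by (intro sets_PiM_I) auto
  have "(\<lambda>\<omega>. \<lambda>u\<in>{0..}. J (s + u) \<omega> - J s \<omega>) -` prod_emb {0..} (\<lambda>_. borel) G (Pi\<^sub>E G B) \<inter> space M =
      {\<omega> \<in> space M. \<forall>u\<in>G. J (s + u) \<omega> - J s \<omega> \<in> B u}"
    "(\<lambda>\<omega>. \<lambda>u\<in>{0..}. J u \<omega>) -` prod_emb {0..} (\<lambda>_. borel) G (Pi\<^sub>E G B) \<inter> space M =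
      {\<omega> \<in> space M. \<forall>u\<in>G. J u \<omega> \<in> B u}"
    using G(2) by (fastforce simp: prod_emb_def PiE_iff)+
  then show "emeasure (distr M (\<Pi>\<^sub>M u\<in>{0..}. borel) (\<lambda>\<omega>. \<lambda>u\<in>{0..}. J (s + u) \<omega> - J s \<omega>)) (prod_emb {0..} (\<lambda>_. borel) G (Pi\<^sub>E G B)) =
      emeasure (distr M (\<Pi>\<^sub>M u\<in>{0..}. borel) (\<lambda>\<omega>. \<lambda>u\<in>{0..}. J u \<omega>)) (prod_emb {0..} (\<lambda>_. borel) G (Pi\<^sub>E G B))"
    using levy_shift_cylinder[OF s G] by (simp add: emeasure_distr meas emb emeasure_eq_measure)
qed auto

end

section \<open>Running minima of right-continuous paths\<close>

text \<open>The \<open>n\<close>-th argument is the first multiple of \<open>1 / Suc n\<close>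
  strictly to the right of \<open>t\<close>, when \<open>t\<close> is nonnegative. The limit thus
  recovers \<open>f t\<close> for right-continuous \<open>f\<close>. Each approximation reads
  \<open>f\<close> at countably many times only, which makes evaluation jointly measurable in path
  and time. Through \<open>nat\<close> only nonnegative times are ever read.\<close>

definition right_eval :: "(real \<Rightarrow> real) \<Rightarrow> real \<Rightarrow> real" where
  "right_eval f t = lim (\<lambda>n. f ((real (nat \<lfloor>real (Suc n) * t\<rfloor>) + 1) / real (Suc n)))"

lemma right_eval_cong:
  assumes "\<And>u. 0 \<le> u \<Longrightarrow> f u = g u"
  shows "right_eval f = right_eval g"
  unfolding right_eval_def[abs_def] by (simp add: assms)

lemma right_eval_eq:
  assumes t: "0 \<le> t" and f: "continuous (at_right t) f"
  shows "right_eval f t = f t"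
proof -
  let ?g = "\<lambda>n. (real (nat \<lfloor>real (Suc n) * t\<rfloor>) + 1) / real (Suc n)"
  have fl: "real (nat \<lfloor>real (Suc n) * t\<rfloor>) = of_int \<lfloor>real (Suc n) * t\<rfloor>" for n
    using t by (intro of_nat_nat) simp
  have lower: "t < ?g n" for n
    unfolding fl using floor_correct[of "real (Suc n) * t"] by (simp add: pos_less_divide_eq mult.commute)
  have upper: "?g n \<le> t + 1 / real (Suc n)" for n
  proof -
    have "?g n \<le> (real (Suc n) * t + 1) / real (Suc n)"
      unfolding fl by (intro divide_right_mono add_right_mono) (auto simp del: of_nat_Suc)
    also have "\<dots> = t + 1 / real (Suc n)" by (simp add: field_simps)
    finally show ?thesis .
  qed
  have "?g \<longlonglongrightarrow> t"
  proof (rule tendsto_sandwich[where f="\<lambda>_. t" and h="\<lambda>n. t + 1 / real (Suc n)"])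
    show "(\<lambda>n. t + 1 / real (Suc n)) \<longlonglongrightarrow> t"
      using tendsto_add[OF tendsto_const LIMSEQ_inverse_real_of_nat, of t] by (simp add: inverse_eq_divide)
    show "\<forall>\<^sub>F n in sequentially. t \<le> ?g n" using lower by (intro always_eventually allI less_imp_le)
    show "\<forall>\<^sub>F n in sequentially. ?g n \<le> t + 1 / real (Suc n)" using upper by (intro always_eventually allI)
  qed simp
  then have "filterlim ?g (at_right t) sequentially"
    using lower less_imp_neq[OF lower, symmetric]
    by (auto simp: filterlim_at intro!: always_eventually simp del: of_nat_Suc)
  with f have "(\<lambda>n. f (?g n)) \<longlonglongrightarrow> f t"
    unfolding continuous_within by (rule filterlim_compose)
  then show ?thesis unfolding right_eval_def by (rule limI)
qed

lemma borel_measurable_right_eval: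
  assumes f: "f \<in> measurable N (PiM {0..} (\<lambda>_. borel))" and t[measurable]: "t \<in> borel_measurable N"
  shows "(\<lambda>x. right_eval (f x) (t x)) \<in> borel_measurable N"
  unfolding right_eval_def
proof (rule borel_measurable_lim_metric)
  fix n
  show "(\<lambda>x. f x ((real (nat \<lfloor>real (Suc n) * t x\<rfloor>) + 1) / real (Suc n))) \<in> borel_measurable N"
  \<comment> \<open>For fixed \<open>n\<close> the time of evaluation is determined by a natural
    number, so a countable case distinction reduces the claim to coordinates at deterministic
    times.\<close>
  proof (rule measurable_compose_countable[where f="\<lambda>i x. f x ((real i + 1) / real (Suc n))"])
    fix i :: nat
    show "(\<lambda>x. f x ((real i + 1) / real (Suc n))) \<in> borel_measurable N"
      by (rule measurable_compose[OF f]) (rule measurable_component_singleton, simp)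
    show "(\<lambda>x. nat \<lfloor>real (Suc n) * t x\<rfloor>) \<in> measurable N (count_space UNIV)"
      by measurable
  qed
qed

text \<open>For right-continuous \<open>f\<close>, this says that \<open>u \<mapsto> f u - u\<close> attains its minimum over
  \<open>[0, t]\<close> at \<open>t\<close>. Testing only rational fractions of \<open>t\<close> keeps the event measurable.\<close>

definition running_min :: "(real \<Rightarrow> real) \<Rightarrow> real \<Rightarrow> bool" where
  "running_min f t \<longleftrightarrow> (\<forall>q\<in>\<rat> \<inter> {0..1}. f t - t \<le> f (q * t) - q * t)"

lemma running_min_cong:
  assumes "\<And>u. 0 \<le> u \<Longrightarrow> u \<le> t \<Longrightarrow> f u = g u" "0 \<le> t"
  shows "running_min f t \<longleftrightarrow> running_min g t"
proof -
  have "f (q * t) = g (q * t)" if "q \<in> \<rat> \<inter> {0..1}" for q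
    using that assms(2) by (intro assms) (auto intro: mult_left_le_one_le)
  then show ?thesis using assms by (simp add: running_min_def)
qed

text \<open>If a lower value occurs at some \<open>u\<close> before \<open>t\<close>,
  right-continuity spreads it to an interval to the right of \<open>u\<close>, and this interval
  contains a rational fraction of \<open>t\<close>.\<close>

lemma running_min_iff:
  assumes f: "\<And>u. 0 \<le> u \<Longrightarrow> continuous (at_right u) f" and t: "0 \<le> t"
  shows "running_min f t \<longleftrightarrow> (\<forall>u\<in>{0..t}. f t - t \<le> f u - u)"
proof
  assume min: "running_min f t"
  show "\<forall>u\<in>{0..t}. f t - t \<le> f u - u"
  proof (rule ccontr)
    assume "\<not> (\<forall>u\<in>{0..t}. f t - t \<le> f u - u)"
    then obtain u where u: "0 \<le> u" "u \<le> t" "f u - u < f t - t" by auto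
    then have "u < t" by (cases "u = t") auto
    have "((\<lambda>v. f v - v) \<longlongrightarrow> f u - u) (at_right u)"
      using f[OF u(1)] by (intro tendsto_intros) (simp_all add: continuous_within)
    then have "\<forall>\<^sub>F v in at_right u. f v - v < f t - t"
      using u(3) by (rule order_tendstoD)
    then obtain b where b: "u < b" "\<And>v. u < v \<Longrightarrow> v < b \<Longrightarrow> f v - v < f t - t"
      by (auto simp: eventually_at_right_field)
    \<comment> \<open>Capping \<open>b\<close> at \<open>t\<close> keeps the rational
      \<open>q\<close> found next below 1, so that \<open>q * t\<close> is one of the tested
      times.\<close>
    have "u / t < min b t / t"
      using \<open>u < t\<close> u(1) b(1) by (intro divide_strict_right_mono) auto
    then obtain q where q: "q \<in> \<rat>" "u / t < q" "q < min b t / t"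
      using Rats_dense_in_real by blast
    have "u < q * t" "q * t < min b t"
      using q \<open>u < t\<close> u(1) by (simp_all add: pos_divide_less_eq pos_less_divide_eq)
    moreover have "0 \<le> u / t" using \<open>u < t\<close> u(1) by simp
    then have "0 \<le> q" using q(2) by linarith
    moreover from calculation have "q \<in> {0..1}"
      using \<open>u < t\<close> u(1) by (auto simp: mult_less_cancel_right2)
    ultimately show False
      using min b(2)[of "q * t"] q(1) by (auto simp: running_min_def dest!: bspec[of _ _ q])
  qed
next
  assume *: "\<forall>u\<in>{0..t}. f t - t \<le> f u - u"
  have "q * t \<in> {0..t}" if "q \<in> {0..1}" for q :: real
    using that t by (auto intro: mult_left_le_one_le)
  with * show "running_min f t" by (simp add: running_min_def)
qed

text \<open>Regeneration of the queue: before \<open>s\<close> the values of \<open>f u - u\<close>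
  are at least the one at \<open>s\<close>, so a minimum over \<open>[s, t]\<close> attained at
  \<open>t\<close> is automatically one over \<open>[0, t]\<close>. On \<open>[s, t]\<close> only
  increments after \<open>s\<close> enter.\<close>

lemma running_min_split:
  assumes f: "\<And>u. 0 \<le> u \<Longrightarrow> continuous (at_right u) f" and st: "0 \<le> s" "s \<le> t"
    and s: "running_min f s"
  shows "running_min f t \<longleftrightarrow> running_min (\<lambda>u. f (s + u) - f s) (t - s)"
proof -
  have "continuous (at_right u) (\<lambda>u. f (s + u) - f s)" if "0 \<le> u" for u
  proof -
    have "(f \<longlongrightarrow> f (u + s)) (at_right (u + s))"
      using f[of "u + s"] that st by (simp add: continuous_within)
    then have "((\<lambda>v. f (v + s)) \<longlongrightarrow> f (u + s)) (at_right u)"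
      by (subst (asm) at_right_to_0) (subst at_right_to_0, simp add: filterlim_filtermap ac_simps)
    then show ?thesis
      by (auto simp: continuous_within add.commute intro!: tendsto_intros)
  qed
  then have "running_min (\<lambda>u. f (s + u) - f s) (t - s) \<longleftrightarrow>
      (\<forall>u\<in>{0..t - s}. f (s + (t - s)) - f s - (t - s) \<le> f (s + u) - f s - u)"
    using st by (intro running_min_iff) auto
  also have "\<dots> \<longleftrightarrow> (\<forall>v\<in>{s..t}. f t - t \<le> f v - v)"
  proof safe
    fix v assume "\<forall>u\<in>{0..t - s}. f (s + (t - s)) - f s - (t - s) \<le> f (s + u) - f s - u" "v \<in> {s..t}"
    from bspec[OF this(1), of "v - s"] this(2) show "f t - t \<le> f v - v" by simp
  next
    fix u assume "\<forall>v\<in>{s..t}. f t - t \<le> f v - v" "u \<in> {0..t - s}"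
    from bspec[OF this(1), of "s + u"] this(2)
    show "f (s + (t - s)) - f s - (t - s) \<le> f (s + u) - f s - u" by simp
  qed
  also have "\<dots> \<longleftrightarrow> (\<forall>v\<in>{0..t}. f t - t \<le> f v - v)"
  proof safe
    fix v assume *: "\<forall>v\<in>{s..t}. f t - t \<le> f v - v" and v: "v \<in> {0..t}"
    show "f t - t \<le> f v - v"
    proof (cases "v \<le> s")
      case True
      then have "f s - s \<le> f v - v" using running_min_iff[OF f st(1)] s v by auto
      moreover have "f t - t \<le> f s - s" using * st by auto
      ultimately show ?thesis by simp
    qed (use * v in auto)
  qed (use st in auto)
  also have "\<dots> \<longleftrightarrow> running_min f t" using running_min_iff[OF f, of t] st by auto
  finally show ?thesis by simp
qed

lemma pred_running_min:
  assumes f: "\<And>q. q \<in> \<rat> \<inter> {0..1} \<Longrightarrow> (\<lambda>x. f x (q * t x)) \<in> borel_measurable N"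
    and t[measurable]: "t \<in> borel_measurable N"
  shows "Measurable.pred N (\<lambda>x. running_min (f x) (t x))"
proof -
  have [measurable]: "(\<lambda>x. f x (t x)) \<in> borel_measurable N" using f[of 1] by simp
  have "{x \<in> space N. \<forall>q\<in>\<rat> \<inter> {0..1}. f x (t x) - t x \<le> f x (q * t x) - q * t x} \<in> sets N"
  proof (rule sets.sets_Collect_countable_All')
    fix q :: real assume "q \<in> \<rat> \<inter> {0..1}"
    note [measurable] = f[OF this]
    show "{x \<in> space N. f x (t x) - t x \<le> f x (q * t x) - q * t x} \<in> sets N" by measurable
  qed (simp add: countable_rat countable_Int1)
  then show ?thesis by (simp add: running_min_def pred_def)
qed

text \<open>At a deterministic time only coordinates in \<open>[0, t]\<close> are tested. Taking
  \<open>I\<close> as a bounded interval shows that the event belongs to the past; taking all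
  nonnegative times serves for the future.\<close>

lemma pred_running_min_PiM:
  assumes t: "0 \<le> t" and I: "{0..t} \<subseteq> I"
  shows "Measurable.pred (PiM I (\<lambda>_. borel)) (\<lambda>f. running_min f t)"
proof (rule pred_running_min)
  fix q :: real assume "q \<in> \<rat> \<inter> {0..1}"
  then have "q * t \<in> I" using t I by (auto intro!: subsetD[OF I] mult_left_le_one_le)
  then show "(\<lambda>f. f (q * t)) \<in> borel_measurable (PiM I (\<lambda>_. borel :: real measure))"
    by (rule measurable_component_singleton)
qed simp

text \<open>With \<open>s\<close> the epochs and an empty start, this is the event
  \<open>R = l\<close>. Index 0 is left out because the queue is empty there by assumption and
  \<open>R\<close> counts from 1.\<close>

definition first_min :: "nat \<Rightarrow> (real \<Rightarrow> real) \<Rightarrow> (nat \<Rightarrow> real) \<Rightarrow> bool" where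
  "first_min l f s \<longleftrightarrow> running_min f (s l) \<and> (\<forall>j\<in>{1..<l}. \<not> running_min f (s j))"

lemma first_min_cong:
  assumes "1 \<le> l" "\<And>j. j \<in> {1..l} \<Longrightarrow> s j = s' j" "\<And>j. j \<in> {1..l} \<Longrightarrow> 0 \<le> s j"
    and "\<And>j u. j \<in> {1..l} \<Longrightarrow> 0 \<le> u \<Longrightarrow> u \<le> s j \<Longrightarrow> f u = g u"
  shows "first_min l f s \<longleftrightarrow> first_min l g s'"
proof -
  have "running_min f (s j) = running_min g (s' j)" if "j \<in> {1..l}" for j
    using assms(2)[OF that] assms(3)[OF that] assms(4)[OF that] running_min_cong[of "s j" f g] by simp
  then show ?thesis using assms(1) by (auto simp: first_min_def)
qed

text \<open>This is what makes the first return decompose the event of an empty queue at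
  \<open>k\<close> into disjoint cases; \<open>l\<close> is the least index with a minimum.\<close>

lemma ex1_first_min:
  assumes "running_min f (s k)" "1 \<le> k"
  shows "\<exists>!l. l \<in> {1..k} \<and> first_min l f s"
proof -
  let ?P = "\<lambda>l. 1 \<le> l \<and> running_min f (s l)"
  define l where "l = (LEAST l. ?P l)"
  have l: "?P l" unfolding l_def using assms by (intro LeastI[of ?P k]) auto
  have least: "l \<le> j" if "?P j" for j unfolding l_def using that by (rule Least_le)
  show ?thesis
  proof (rule ex1I[of _ l])
    show "l \<in> {1..k} \<and> first_min l f s"
      using l least assms by (fastforce simp: first_min_def)
  next
    fix j assume "j \<in> {1..k} \<and> first_min j f s"
    then show "j = l" using l least[of j] by (cases "l < j") (auto simp: first_min_def)
  qed
qed

section \<open>Events of the sampled queue\<close>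

text \<open>An event of the sampled queue, as a predicate of the path \<open>f\<close> and the epochs \<open>s\<close>, to which
  Fubini's theorem applies: evaluation of a path at a random time is not measurable for the
  product \<open>\<sigma>\<close>-algebra on all paths, so it is replaced by \<open>right_eval\<close>.\<close>

definition sampled_event :: "((real \<Rightarrow> real) \<Rightarrow> (nat \<Rightarrow> real) \<Rightarrow> bool) \<Rightarrow> bool" where
  "sampled_event G \<longleftrightarrow>
    Measurable.pred (PiM {0..} (\<lambda>_. borel) \<Otimes>\<^sub>M PiM {1..} (\<lambda>_. borel))
      (\<lambda>(f, \<tau>). G (right_eval f) (\<lambda>k. \<Sum>i=1..k. \<tau> i)) \<and>
    (\<forall>f g s. (\<forall>u\<ge>0. f u = g u) \<longrightarrow> (\<forall>j. 0 \<le> s j) \<longrightarrow> G f s = G g s)"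

lemma sampled_event_cong:
  assumes "sampled_event G" "\<And>u. 0 \<le> u \<Longrightarrow> f u = g u" "\<And>j. 0 \<le> s j"
  shows "G f s = G g s"
  using assms unfolding sampled_event_def by blast

lemma sampled_event_not:
  assumes "sampled_event G"
  shows "sampled_event (\<lambda>f s. \<not> G f s)"
  unfolding sampled_event_def
proof
  have "Measurable.pred (PiM {0..} (\<lambda>_. borel) \<Otimes>\<^sub>M PiM {1..} (\<lambda>_. borel))
      (\<lambda>z. G (right_eval (fst z)) (\<lambda>k. \<Sum>i=1..k. snd z i))"
    using assms by (simp add: sampled_event_def case_prod_unfold)
  then show "Measurable.pred (PiM {0..} (\<lambda>_. borel) \<Otimes>\<^sub>M PiM {1..} (\<lambda>_. borel))
      (\<lambda>(f, \<tau>). \<not> G (right_eval f) (\<lambda>k. \<Sum>i=1..k. \<tau> i))"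
    by (simp add: case_prod_unfold)
qed (use assms in \<open>auto simp: sampled_event_def\<close>)

lemma sampled_event_conj:
  assumes "sampled_event G" "sampled_event H"
  shows "sampled_event (\<lambda>f s. G f s \<and> H f s)"
  unfolding sampled_event_def
proof
  have "Measurable.pred (PiM {0..} (\<lambda>_. borel) \<Otimes>\<^sub>M PiM {1..} (\<lambda>_. borel))
      (\<lambda>z. G (right_eval (fst z)) (\<lambda>k. \<Sum>i=1..k. snd z i))"
    "Measurable.pred (PiM {0..} (\<lambda>_. borel) \<Otimes>\<^sub>M PiM {1..} (\<lambda>_. borel))
      (\<lambda>z. H (right_eval (fst z)) (\<lambda>k. \<Sum>i=1..k. snd z i))"
    using assms by (simp_all add: sampled_event_def case_prod_unfold)
  then show "Measurable.pred (PiM {0..} (\<lambda>_. borel) \<Otimes>\<^sub>M PiM {1..} (\<lambda>_. borel))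
      (\<lambda>(f, \<tau>). G (right_eval f) (\<lambda>k. \<Sum>i=1..k. \<tau> i) \<and> H (right_eval f) (\<lambda>k. \<Sum>i=1..k. \<tau> i))"
    by (simp add: case_prod_unfold)
next
  show "\<forall>f g s. (\<forall>u\<ge>0. f u = g u) \<longrightarrow> (\<forall>j. 0 \<le> s j) \<longrightarrow> (G f s \<and> H f s) = (G g s \<and> H g s)"
    using assms unfolding sampled_event_def by blast
qed

lemma sampled_event_ball:
  assumes "finite I" "\<And>i. i \<in> I \<Longrightarrow> sampled_event (G i)"
  shows "sampled_event (\<lambda>f s. \<forall>i\<in>I. G i f s)"
  unfolding sampled_event_def
proof
  have "Measurable.pred (PiM {0..} (\<lambda>_. borel) \<Otimes>\<^sub>M PiM {1..} (\<lambda>_. borel))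
      (\<lambda>z. \<forall>i\<in>I. G i (right_eval (fst z)) (\<lambda>k. \<Sum>i=1..k. snd z i))"
    using assms by (intro pred_intros_finite) (simp_all add: sampled_event_def case_prod_unfold)
  then show "Measurable.pred (PiM {0..} (\<lambda>_. borel) \<Otimes>\<^sub>M PiM {1..} (\<lambda>_. borel))
      (\<lambda>(f, \<tau>). \<forall>i\<in>I. G i (right_eval f) (\<lambda>k. \<Sum>i=1..k. \<tau> i))"
    by (simp add: case_prod_unfold)
next
  show "\<forall>f g s. (\<forall>u\<ge>0. f u = g u) \<longrightarrow> (\<forall>j. 0 \<le> s j) \<longrightarrow> (\<forall>i\<in>I. G i f s) = (\<forall>i\<in>I. G i g s)"
    using assms(2) unfolding sampled_event_def by blast
qed

lemma sampled_event_running_min: "sampled_event (\<lambda>f s. running_min f (s k))"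
  unfolding sampled_event_def
proof
  let ?N = "PiM {0..} (\<lambda>_. borel :: real measure) \<Otimes>\<^sub>M PiM {1..} (\<lambda>_. borel :: real measure)"
  have t[measurable]: "(\<lambda>z. \<Sum>i=1..k. snd z i) \<in> borel_measurable ?N"
    by (rule measurable_compose[OF measurable_snd borel_measurable_sum_component]) auto
  have "Measurable.pred ?N (\<lambda>z. running_min (right_eval (fst z)) (\<Sum>i=1..k. snd z i))"
    by (intro pred_running_min borel_measurable_right_eval measurable_fst) measurable
  then show "Measurable.pred ?N (\<lambda>(f, \<tau>). running_min (right_eval f) (\<Sum>i=1..k. \<tau> i))"
    by (simp add: case_prod_unfold)
qed (auto intro!: running_min_cong)

lemma sampled_event_first_min: "sampled_event (first_min l)"
  unfolding first_min_def[abs_def]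
  by (intro sampled_event_conj sampled_event_ball sampled_event_not sampled_event_running_min) simp

section \<open>Sampled events at deterministic epochs\<close>

context levy_process
begin

lemma right_continuous_path: "\<omega> \<in> space M \<Longrightarrow> 0 \<le> t \<Longrightarrow> continuous (at_right t) (\<lambda>t. J t \<omega>)"
  using levy_cadlag[of \<omega>] by (simp add: cadlag_def)

lemma right_eval_path:
  assumes "\<omega> \<in> space M" "0 \<le> t"
  shows "right_eval (\<lambda>u\<in>{0..}. J u \<omega>) t = J t \<omega>"
proof -
  have "right_eval (\<lambda>u\<in>{0..}. J u \<omega>) = right_eval (\<lambda>u. J u \<omega>)"
    by (rule right_eval_cong) simp
  then show ?thesis
    using right_eval_eq[OF assms(2) right_continuous_path[OF assms]] by simp
qed

lemma measurable_path: "(\<lambda>\<omega>. \<lambda>u\<in>{0..}. J u \<omega>) \<in> measurable M (PiM {0..} (\<lambda>_. borel))"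
  by (rule measurable_restrict) (simp add: levy_measurable)

lemma sampled_event_path:
  assumes "sampled_event G" "\<omega> \<in> space M" "\<And>j. 0 \<le> s j"
  shows "G (right_eval (\<lambda>u\<in>{0..}. J u \<omega>)) s = G (\<lambda>t. J t \<omega>) s"
  using assms by (intro sampled_event_cong[of G] right_eval_path)

lemma borel_measurable_prob_sampled_event:
  assumes G: "sampled_event G" and h[measurable]: "h \<in> measurable N (PiM {1..} (\<lambda>_. borel))"
  shows "(\<lambda>x. \<P>(\<omega> in M. G (right_eval (\<lambda>u\<in>{0..}. J u \<omega>)) (\<lambda>k. \<Sum>i=1..k. h x i))) \<in> borel_measurable N"
proof (rule measurable_measure)
  have pred: "Measurable.pred (PiM {0..} (\<lambda>_. borel) \<Otimes>\<^sub>M PiM {1..} (\<lambda>_. borel))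
      (\<lambda>z. G (right_eval (fst z)) (\<lambda>k. \<Sum>i=1..k. snd z i))"
    using G by (simp add: sampled_event_def case_prod_unfold)
  have pair: "(\<lambda>z. (\<lambda>u\<in>{0..}. J u (snd z), h (fst z))) \<in> measurable (N \<Otimes>\<^sub>M M) (PiM {0..} (\<lambda>_. borel) \<Otimes>\<^sub>M PiM {1..} (\<lambda>_. borel))"
    by (intro measurable_Pair measurable_compose[OF measurable_snd measurable_path] measurable_compose[OF measurable_fst h])
  have "Measurable.pred (N \<Otimes>\<^sub>M M)
      (\<lambda>z. G (right_eval (\<lambda>u\<in>{0..}. J u (snd z))) (\<lambda>k. \<Sum>i=1..k. h (fst z) i))"
    using measurable_compose[OF pair pred] by simp
  moreover have "{x \<in> space (N \<Otimes>\<^sub>M M). snd x \<in> {\<omega> \<in> space M. G (right_eval (\<lambda>u\<in>{0..}. J u \<omega>)) (\<lambda>k. \<Sum>i=1..k. h (fst x) i)}} =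
      {x \<in> space (N \<Otimes>\<^sub>M M). G (right_eval (\<lambda>u\<in>{0..}. J u (snd x))) (\<lambda>k. \<Sum>i=1..k. h (fst x) i)}"
    by (auto simp: space_pair_measure)
  ultimately show "{x \<in> space (N \<Otimes>\<^sub>M M). snd x \<in> {\<omega> \<in> space M. G (right_eval (\<lambda>u\<in>{0..}. J u \<omega>)) (\<lambda>k. \<Sum>i=1..k. h (fst x) i)}} \<in> sets (N \<Otimes>\<^sub>M M)"
    by (simp add: pred_def)
qed auto

lemma prob_running_min_shift:
  assumes s: "0 \<le> s" and t: "0 \<le> t"
  shows "\<P>(\<omega> in M. running_min (\<lambda>u. J (s + u) \<omega> - J s \<omega>) t) = \<P>(\<omega> in M. running_min (\<lambda>u. J u \<omega>) t)"
proof -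
  let ?Q = "{f \<in> space (PiM {0..} (\<lambda>_. borel)). running_min f t}"
  have Q: "?Q \<in> sets (PiM {0..} (\<lambda>_. borel))"
    using pred_running_min_PiM[OF t, of "{0..}"] by (auto simp: pred_def)
  have shift: "(\<lambda>\<omega>. \<lambda>u\<in>{0..}. J (s + u) \<omega> - J s \<omega>) \<in> measurable M (PiM {0..} (\<lambda>_. borel))"
    using s by (intro measurable_restrict borel_measurable_diff levy_measurable) auto
  have "measure (distr M (PiM {0..} (\<lambda>_. borel)) (\<lambda>\<omega>. \<lambda>u\<in>{0..}. X u \<omega>)) ?Q = \<P>(\<omega> in M. running_min (\<lambda>u. X u \<omega>) t)"
    if "(\<lambda>\<omega>. \<lambda>u\<in>{0..}. X u \<omega>) \<in> measurable M (PiM {0..} (\<lambda>_. borel))" for X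
  proof -
    have "running_min (\<lambda>u\<in>{0..}. X u \<omega>) t = running_min (\<lambda>u. X u \<omega>) t" for \<omega>
      using t by (intro running_min_cong) auto
    then show ?thesis
      using measurable_space[OF that] by (subst measure_distr[OF that Q]) (auto intro!: arg_cong[where f=prob])
  qed
  from this[OF shift] this[OF measurable_path] show ?thesis
    using levy_shift_distr[OF s] by simp
qed

text \<open>The renewal step for deterministic epochs. \<open>first_min l\<close> is determined by
  the path up to \<open>s l\<close>. On this event the minimum at \<open>s k\<close> is, by
  \<open>running_min_split\<close>, an event of the increments after \<open>s l\<close>. The Markov
  property factors the probability, and stationarity moves the second factor back to time 0.\<close>

lemma prob_first_min_split:
  assumes l: "1 \<le> l" "l \<le> k" and s: "mono s" "0 \<le> s 0"
  shows "\<P>(\<omega> in M. first_min l (\<lambda>t. J t \<omega>) s \<and> running_min (\<lambda>t. J t \<omega>) (s k)) =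
    \<P>(\<omega> in M. first_min l (\<lambda>t. J t \<omega>) s) * \<P>(\<omega> in M. running_min (\<lambda>t. J t \<omega>) (s k - s l))"
proof -
  have s_nonneg: "0 \<le> s j" for j using monoD[OF s(1), of 0 j] s(2) by simp
  have s_le: "s j \<le> s l" if "j \<in> {1..l}" for j using monoD[OF s(1)] that by simp
  have gap: "0 \<le> s k - s l" using monoD[OF s(1) l(2)] by simp
  have past: "first_min l (\<lambda>u\<in>{0..s l}. J u \<omega>) s = first_min l (\<lambda>t. J t \<omega>) s" for \<omega>
  proof (rule first_min_cong)
    show "(\<lambda>u\<in>{0..s l}. J u \<omega>) u = J u \<omega>" if "j \<in> {1..l}" "0 \<le> u" "u \<le> s j" for j u
      using that(2,3) s_le[OF that(1)] by simp
  qed (use l s_nonneg in auto)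
  have future: "running_min (\<lambda>u\<in>{0..}. J (s l + u) \<omega> - J (s l) \<omega>) (s k - s l) =
      running_min (\<lambda>u. J (s l + u) \<omega> - J (s l) \<omega>) (s k - s l)" for \<omega>
    using gap by (intro running_min_cong) auto
  have "Measurable.pred (PiM {0..s l} (\<lambda>_. borel)) (\<lambda>f. running_min f (s j))" if "j \<in> {1..l}" for j
    using s_nonneg s_le[OF that] by (intro pred_running_min_PiM) auto
  then have pred_past: "Measurable.pred (PiM {0..s l} (\<lambda>_. borel)) (\<lambda>f. first_min l f s)"
    unfolding first_min_def using l(1) by (intro pred_intros_logic pred_intros_finite) auto
  have pred_future: "Measurable.pred (PiM {0..} (\<lambda>_. borel)) (\<lambda>f. running_min f (s k - s l))"
    using gap by (intro pred_running_min_PiM) auto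
  have "first_min l (\<lambda>t. J t \<omega>) s \<and> running_min (\<lambda>t. J t \<omega>) (s k) \<longleftrightarrow>
      first_min l (\<lambda>t. J t \<omega>) s \<and> running_min (\<lambda>u. J (s l + u) \<omega> - J (s l) \<omega>) (s k - s l)"
    if "\<omega> \<in> space M" for \<omega>
    using running_min_split[of "\<lambda>t. J t \<omega>" "s l" "s k"] right_continuous_path[OF that] s_nonneg gap
    by (auto simp: first_min_def)
  then have "\<P>(\<omega> in M. first_min l (\<lambda>t. J t \<omega>) s \<and> running_min (\<lambda>t. J t \<omega>) (s k)) =
      \<P>(\<omega> in M. first_min l (\<lambda>t. J t \<omega>) s \<and> running_min (\<lambda>u. J (s l + u) \<omega> - J (s l) \<omega>) (s k - s l))"
    by (intro arg_cong[where f=prob]) blast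
  also have "\<dots> = \<P>(\<omega> in M. first_min l (\<lambda>t. J t \<omega>) s) *
      \<P>(\<omega> in M. running_min (\<lambda>u. J (s l + u) \<omega> - J (s l) \<omega>) (s k - s l))"
    using indep_elements_prob_conj[OF levy_markov[OF s_nonneg] pred_past pred_future]
    unfolding past future .
  also have "\<P>(\<omega> in M. running_min (\<lambda>u. J (s l + u) \<omega> - J (s l) \<omega>) (s k - s l)) =
      \<P>(\<omega> in M. running_min (\<lambda>t. J t \<omega>) (s k - s l))"
    using s_nonneg gap by (rule prob_running_min_shift)
  finally show ?thesis .
qed

end

section \<open>Integration over the random epochs\<close>

context poisson_sampled_queue
begin

lemma epoch_nonneg: "\<omega> \<in> space M \<Longrightarrow> 0 \<le> epoch T k \<omega>"
  unfolding epoch_def by (intro sum_nonneg T_nonneg) auto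

lemma mono_epoch: "\<omega> \<in> space M \<Longrightarrow> mono (\<lambda>k. epoch T k \<omega>)"
  unfolding epoch_def mono_def by (auto intro!: sum_mono2 T_nonneg)

lemma epoch_diff: "l \<le> k \<Longrightarrow> epoch T k \<omega> - epoch T l \<omega> = (\<Sum>i=l+1..k. T i \<omega>)"
  using sum.ub_add_nat[of 1 l "\<lambda>i. T i \<omega>" "k - l"] by (simp add: epoch_def)

text \<open>Replacing the path by its \<open>right_eval\<close> changes no outcome but gives a
  jointly measurable predicate, so Fubini can freeze the epochs. The last claim is what lets the
  conditioning on an empty start cancel.\<close>

lemma prob_sampled_event:
  assumes G: "sampled_event G"
  shows "{\<omega> \<in> space M. G (\<lambda>t. J t \<omega>) (\<lambda>k. epoch T k \<omega>)} \<in> events" (is ?sets)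
    and "\<P>(\<omega> in M. G (\<lambda>t. J t \<omega>) (\<lambda>k. epoch T k \<omega>)) =
      (\<integral>\<omega>'. \<P>(\<omega> in M. G (\<lambda>t. J t \<omega>) (\<lambda>k. epoch T k \<omega>')) \<partial>M)" (is ?fubini)
    and "\<P>(\<omega> in M. V0 \<omega> = 0 \<and> G (\<lambda>t. J t \<omega>) (\<lambda>k. epoch T k \<omega>)) =
      \<P>(\<omega> in M. V0 \<omega> = 0) * \<P>(\<omega> in M. G (\<lambda>t. J t \<omega>) (\<lambda>k. epoch T k \<omega>))" (is ?V0)
proof -
  let ?P = "PiM {0..} (\<lambda>_. borel :: real measure)" and ?T = "PiM {1..} (\<lambda>_. borel :: real measure)"
  let ?J = "\<lambda>\<omega>. \<lambda>u\<in>{0..}. J u \<omega>" and ?\<tau> = "\<lambda>\<omega>. \<lambda>i\<in>{1..}. T i \<omega>"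
  let ?G = "\<lambda>f \<tau>. G (right_eval f) (\<lambda>k. \<Sum>i=1..k. \<tau> i)"
  have G_eq: "?G (?J \<omega>) (?\<tau> \<omega>') = G (\<lambda>t. J t \<omega>) (\<lambda>k. epoch T k \<omega>')"
    if "\<omega> \<in> space M" "\<omega>' \<in> space M" for \<omega> \<omega>'
  proof -
    have "(\<lambda>k. \<Sum>i=1..k. ?\<tau> \<omega>' i) = (\<lambda>k. epoch T k \<omega>')"
      by (simp add: epoch_def)
    then show ?thesis using sampled_event_path[OF G that(1), of "\<lambda>k. epoch T k \<omega>'"] epoch_nonneg[OF that(2)] by simp
  qed
  have pred_G: "Measurable.pred (?P \<Otimes>\<^sub>M ?T) (\<lambda>z. ?G (fst z) (snd z))"
    using G by (simp add: sampled_event_def case_prod_unfold)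
  have J_meas: "?J \<in> measurable M ?P" by (rule measurable_path)
  have \<tau>_meas: "?\<tau> \<in> measurable M ?T" using J_V0_T_indep by (simp add: indep_elements_def)
  have "Measurable.pred M (\<lambda>\<omega>. ?G (?J \<omega>) (?\<tau> \<omega>))"
    using measurable_compose[OF measurable_Pair[OF J_meas \<tau>_meas] pred_G] by simp
  moreover have "{\<omega> \<in> space M. ?G (?J \<omega>) (?\<tau> \<omega>)} = {\<omega> \<in> space M. G (\<lambda>t. J t \<omega>) (\<lambda>k. epoch T k \<omega>)}"
    using G_eq by auto
  ultimately show ?sets by (simp add: pred_def)
  \<comment> \<open>Independence from \<open>T\<close> is assumed for the pair of \<open>J\<close>
    and \<open>V0\<close>, so the predicate is pulled back along the projection that forgets
    \<open>V0\<close>.\<close>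
  have proj: "(\<lambda>z. (fst (fst z), snd z)) \<in> measurable ((?P \<Otimes>\<^sub>M borel) \<Otimes>\<^sub>M ?T) (?P \<Otimes>\<^sub>M ?T)"
    by measurable
  have pred1: "Measurable.pred ((?P \<Otimes>\<^sub>M borel) \<Otimes>\<^sub>M ?T) (\<lambda>z. ?G (fst (fst z)) (snd z))"
    using measurable_compose[OF proj pred_G] by simp
  have eq1: "{\<omega> \<in> space M. ?G (?J \<omega>) (?\<tau> \<omega>')} = {\<omega> \<in> space M. G (\<lambda>t. J t \<omega>) (\<lambda>k. epoch T k \<omega>')}"
    if "\<omega>' \<in> space M" for \<omega>'
    using G_eq that by auto
  have eq0: "{\<omega> \<in> space M. ?G (?J \<omega>) (?\<tau> \<omega>)} = {\<omega> \<in> space M. G (\<lambda>t. J t \<omega>) (\<lambda>k. epoch T k \<omega>)}"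
    using G_eq by auto
  have "\<P>(\<omega> in M. ?G (?J \<omega>) (?\<tau> \<omega>)) = (\<integral>\<omega>'. \<P>(\<omega> in M. ?G (?J \<omega>) (?\<tau> \<omega>')) \<partial>M)"
    using prob_indep_elements_eq_integral[OF J_V0_T_indep, of "\<lambda>x \<tau>. ?G (fst x) \<tau>"] pred1
    by (simp add: case_prod_unfold)
  also have "\<dots> = (\<integral>\<omega>'. \<P>(\<omega> in M. G (\<lambda>t. J t \<omega>) (\<lambda>k. epoch T k \<omega>')) \<partial>M)"
    by (rule Bochner_Integration.integral_cong[OF refl]) (simp only: eq1)
  finally show fubini: ?fubini unfolding eq0 .
  have pred2: "Measurable.pred ((?P \<Otimes>\<^sub>M borel) \<Otimes>\<^sub>M ?T) (\<lambda>z. snd (fst z) = (0::real) \<and> ?G (fst (fst z)) (snd z))"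
    using pred1 by measurable
  have "\<P>(\<omega> in M. V0 \<omega> = 0 \<and> ?G (?J \<omega>) (?\<tau> \<omega>)) = (\<integral>\<omega>'. \<P>(\<omega> in M. V0 \<omega> = 0 \<and> ?G (?J \<omega>) (?\<tau> \<omega>')) \<partial>M)"
    using prob_indep_elements_eq_integral[OF J_V0_T_indep, of "\<lambda>x \<tau>. snd x = 0 \<and> ?G (fst x) \<tau>"] pred2
    by (simp add: case_prod_unfold)
  \<comment> \<open>With the epochs frozen, what remains is an event of \<open>J\<close> alone,
    which is independent of \<open>V0\<close>; the factor for \<open>V0\<close> does not depend on
    \<omega>'.\<close>
  also have "\<dots> = (\<integral>\<omega>'. \<P>(\<omega> in M. V0 \<omega> = 0) * \<P>(\<omega> in M. G (\<lambda>t. J t \<omega>) (\<lambda>k. epoch T k \<omega>')) \<partial>M)"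
  proof (rule Bochner_Integration.integral_cong[OF refl])
    fix \<omega>' assume \<omega>': "\<omega>' \<in> space M"
    have "Measurable.pred ?P (\<lambda>f. ?G f (?\<tau> \<omega>'))"
      using measurable_compose[OF measurable_Pair2'[OF measurable_space[OF \<tau>_meas \<omega>']] pred_G] by simp
    from indep_elements_prob_conj[OF J_V0_indep this, of "\<lambda>v. v = 0"]
    show "\<P>(\<omega> in M. V0 \<omega> = 0 \<and> ?G (?J \<omega>) (?\<tau> \<omega>')) =
        \<P>(\<omega> in M. V0 \<omega> = 0) * \<P>(\<omega> in M. G (\<lambda>t. J t \<omega>) (\<lambda>k. epoch T k \<omega>'))"
      unfolding eq1[OF \<omega>'] by (simp add: conj_commute mult.commute)
  qed
  also have "\<dots> = \<P>(\<omega> in M. V0 \<omega> = 0) * \<P>(\<omega> in M. G (\<lambda>t. J t \<omega>) (\<lambda>k. epoch T k \<omega>))"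
    by (simp add: fubini)
  finally have "\<P>(\<omega> in M. V0 \<omega> = 0 \<and> ?G (?J \<omega>) (?\<tau> \<omega>)) =
    \<P>(\<omega> in M. V0 \<omega> = 0) * \<P>(\<omega> in M. G (\<lambda>t. J t \<omega>) (\<lambda>k. epoch T k \<omega>))" .
  moreover have "{\<omega> \<in> space M. V0 \<omega> = 0 \<and> ?G (?J \<omega>) (?\<tau> \<omega>)} =
      {\<omega> \<in> space M. V0 \<omega> = 0 \<and> G (\<lambda>t. J t \<omega>) (\<lambda>k. epoch T k \<omega>)}"
    using G_eq by auto
  ultimately show ?V0 by simp
qed

lemma distr_sum_T:
  assumes "finite I" "I \<noteq> {}" "I \<subseteq> {1..}"
  shows "distr M lborel (\<lambda>\<omega>. \<Sum>i\<in>I. T i \<omega>) = density lborel (erlang_density (card I - 1) \<xi>)"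
proof (rule distributed_distr_eq_density[symmetric, OF exponential_distributed_sum, symmetric])
  show "indep_vars (\<lambda>_. borel) T I" by (rule indep_vars_subset[OF T_indep assms(3)])
qed (use assms rate_pos T_exponential in auto)

text \<open>For frozen epochs the probability is a function \<phi> of the first \<open>l\<close>
  interarrival times times a function \<gamma> of the sum of the next \<open>k - l\<close>. These
  blocks are independent, so the integral of the product factors, and Fubini turns each factor back
  into a probability.\<close>

lemma prob_first_min_and_running_min:
  assumes l: "1 \<le> l" "l < k"
  shows "\<P>(\<omega> in M. first_min l (\<lambda>t. J t \<omega>) (\<lambda>j. epoch T j \<omega>) \<and> running_min (\<lambda>t. J t \<omega>) (epoch T k \<omega>)) =
    \<P>(\<omega> in M. first_min l (\<lambda>t. J t \<omega>) (\<lambda>j. epoch T j \<omega>)) *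
    \<P>(\<omega> in M. running_min (\<lambda>t. J t \<omega>) (epoch T (k - l) \<omega>))"
proof -
  let ?J = "\<lambda>\<omega>. \<lambda>u\<in>{0..}. J u \<omega>"
  \<comment> \<open>Both are written in terms of a full sequence of interarrival times, in order to inherit their
    measurability from that of sampled events.\<close>
  define \<phi> where "\<phi> \<tau> = \<P>(\<omega> in M. first_min l (right_eval (?J \<omega>))
      (\<lambda>k. \<Sum>i=1..k. (\<lambda>i\<in>{1..}. if i \<in> {1..l} then \<tau> i else 0) i))" for \<tau> :: "nat \<Rightarrow> real"
  define \<gamma> where "\<gamma> d = \<P>(\<omega> in M. running_min (right_eval (?J \<omega>)) (\<Sum>i=1..1. (\<lambda>i\<in>{1::nat..}. d) i))" for d
  have T_rv: "random_variable borel (T i)" if "1 \<le> i" for i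
    using T_indep that by (auto simp: indep_vars_def2)
  have \<phi>_meas: "\<phi> \<in> borel_measurable (PiM {1..l} (\<lambda>_. borel))"
    unfolding \<phi>_def[abs_def]
  proof (rule borel_measurable_prob_sampled_event[OF sampled_event_first_min])
    show "(\<lambda>\<tau>. \<lambda>i\<in>{1..}. if i \<in> {1..l} then \<tau> i else 0) \<in> measurable (PiM {1..l} (\<lambda>_. borel :: real measure)) (PiM {1..} (\<lambda>_. borel))"
    proof (rule measurable_restrict)
      fix i
      show "(\<lambda>\<tau>. if i \<in> {1..l} then \<tau> i else 0) \<in> borel_measurable (PiM {1..l} (\<lambda>_. borel :: real measure))"
        by (cases "i \<in> {1..l}") (auto intro: measurable_component_singleton)
    qed
  qed
  have \<gamma>_meas: "\<gamma> \<in> borel_measurable borel"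
    unfolding \<gamma>_def[abs_def]
    by (rule borel_measurable_prob_sampled_event[OF sampled_event_running_min])
      (rule measurable_restrict, simp)
  have \<phi>_eq: "\<phi> (\<lambda>i\<in>{1..l}. T i \<omega>') = \<P>(\<omega> in M. first_min l (\<lambda>t. J t \<omega>) (\<lambda>j. epoch T j \<omega>'))"
    if "\<omega>' \<in> space M" for \<omega>'
  proof -
    have "first_min l (right_eval (?J \<omega>)) (\<lambda>k. \<Sum>i=1..k. (\<lambda>i\<in>{1..}. if i \<in> {1..l} then (\<lambda>i\<in>{1..l}. T i \<omega>') i else 0) i) =
        first_min l (\<lambda>t. J t \<omega>) (\<lambda>j. epoch T j \<omega>')" if \<omega>: "\<omega> \<in> space M" for \<omega>
    proof -
      \<comment> \<open>The sequence padded with zeros has the true epochs only up to index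
        \<open>l\<close>, and \<open>first_min l\<close> looks no further.\<close>
      have s_eq: "(\<Sum>i=1..j. (\<lambda>i\<in>{1..}. if i \<in> {1..l} then (\<lambda>i\<in>{1..l}. T i \<omega>') i else 0) i) = epoch T j \<omega>'"
        if "j \<in> {1..l}" for j
        unfolding epoch_def using that by (intro sum.cong) auto
      show ?thesis
      proof (rule first_min_cong[OF l(1)])
        fix j u assume j: "j \<in> {1..l}"
        show "0 \<le> (\<Sum>i=1..j. (\<lambda>i\<in>{1..}. if i \<in> {1..l} then (\<lambda>i\<in>{1..l}. T i \<omega>') i else 0) i)"
          unfolding s_eq[OF j] using \<open>\<omega>' \<in> space M\<close> by (rule epoch_nonneg)
      qed (simp_all only: s_eq right_eval_path[OF \<omega>])
    qed
    then show ?thesis unfolding \<phi>_def by (intro arg_cong[where f=prob]) blast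
  qed
  have \<gamma>_eq: "\<gamma> d = \<P>(\<omega> in M. running_min (\<lambda>t. J t \<omega>) d)" if "0 \<le> d" for d
  proof -
    have "running_min (right_eval (?J \<omega>)) d = running_min (\<lambda>t. J t \<omega>) d" if "\<omega> \<in> space M" for \<omega>
      using \<open>0 \<le> d\<close> that by (intro running_min_cong right_eval_path) auto
    then show ?thesis unfolding \<gamma>_def by (intro arg_cong[where f=prob]) auto
  qed
  have sum_meas: "(\<lambda>\<tau>. \<Sum>i=l+1..k. \<tau> i :: real) \<in> borel_measurable (PiM {l+1..k} (\<lambda>_. borel))"
    by (rule borel_measurable_sum_component) auto
  have indep: "indep_var borel (\<phi> \<circ> (\<lambda>\<omega>. \<lambda>i\<in>{1..l}. T i \<omega>))
      borel ((\<lambda>\<tau>. \<gamma> (\<Sum>i=l+1..k. \<tau> i)) \<circ> (\<lambda>\<omega>. \<lambda>i\<in>{l+1..k}. T i \<omega>))"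
    by (rule indep_var_compose[OF indep_var_restrict[OF T_indep] \<phi>_meas measurable_compose[OF sum_meas \<gamma>_meas]]) auto
  have \<gamma>_sum: "(\<integral>\<omega>. \<gamma> (\<Sum>i\<in>I. T i \<omega>) \<partial>M) = (\<integral>x. \<gamma> x \<partial>density lborel (erlang_density (card I - 1) \<xi>))"
    if "finite I" "I \<noteq> {}" "I \<subseteq> {1..}" for I
  proof -
    have "(\<lambda>\<omega>. \<Sum>i\<in>I. T i \<omega>) \<in> measurable M lborel"
      using that T_rv by (auto intro!: borel_measurable_sum)
    then show ?thesis
      unfolding distr_sum_T[OF that, symmetric] using \<gamma>_meas by (intro integral_distr[symmetric]) auto
  qed
  have bounded: "\<bar>\<phi> \<tau>\<bar> \<le> 1" "\<bar>\<gamma> d\<bar> \<le> 1" for \<tau> d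
    by (simp_all add: \<phi>_def \<gamma>_def)
  have rv: "random_variable borel (\<phi> \<circ> (\<lambda>\<omega>. \<lambda>i\<in>{1..l}. T i \<omega>))"
    "random_variable borel ((\<lambda>\<tau>. \<gamma> (\<Sum>i=l+1..k. \<tau> i)) \<circ> (\<lambda>\<omega>. \<lambda>i\<in>{l+1..k}. T i \<omega>))"
    using indep_var_rv1[OF indep] indep_var_rv2[OF indep] .
  have "\<P>(\<omega> in M. first_min l (\<lambda>t. J t \<omega>) (\<lambda>j. epoch T j \<omega>) \<and> running_min (\<lambda>t. J t \<omega>) (epoch T k \<omega>)) =
      (\<integral>\<omega>'. \<P>(\<omega> in M. first_min l (\<lambda>t. J t \<omega>) (\<lambda>j. epoch T j \<omega>') \<and>
        running_min (\<lambda>t. J t \<omega>) (epoch T k \<omega>')) \<partial>M)"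
    by (rule prob_sampled_event(2)[OF sampled_event_conj[OF sampled_event_first_min sampled_event_running_min]])
  also have "\<dots> = (\<integral>\<omega>'. (\<phi> \<circ> (\<lambda>\<omega>. \<lambda>i\<in>{1..l}. T i \<omega>)) \<omega>' *
      ((\<lambda>\<tau>. \<gamma> (\<Sum>i=l+1..k. \<tau> i)) \<circ> (\<lambda>\<omega>. \<lambda>i\<in>{l+1..k}. T i \<omega>)) \<omega>' \<partial>M)"
  proof (rule Bochner_Integration.integral_cong[OF refl])
    fix \<omega>' assume \<omega>': "\<omega>' \<in> space M"
    have "(\<Sum>i=l+1..k. (\<lambda>i\<in>{l+1..k}. T i \<omega>') i) = epoch T k \<omega>' - epoch T l \<omega>'"
      using l by (subst epoch_diff) auto
    \<comment> \<open>The gap has to be nonnegative for \<open>\<gamma>_eq\<close>, as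
      \<open>right_eval\<close> is known to agree with the path only at nonnegative times.\<close>
    moreover have "epoch T l \<omega>' \<le> epoch T k \<omega>'" using monoD[OF mono_epoch[OF \<omega>'], of l k] l by simp
    ultimately show "\<P>(\<omega> in M. first_min l (\<lambda>t. J t \<omega>) (\<lambda>j. epoch T j \<omega>') \<and>
        running_min (\<lambda>t. J t \<omega>) (epoch T k \<omega>')) =
        (\<phi> \<circ> (\<lambda>\<omega>. \<lambda>i\<in>{1..l}. T i \<omega>)) \<omega>' *
        ((\<lambda>\<tau>. \<gamma> (\<Sum>i=l+1..k. \<tau> i)) \<circ> (\<lambda>\<omega>. \<lambda>i\<in>{l+1..k}. T i \<omega>)) \<omega>'"
      using prob_first_min_split[of l k "\<lambda>j. epoch T j \<omega>'"] l mono_epoch[OF \<omega>'] epoch_nonneg[OF \<omega>']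
      by (simp only: comp_def \<phi>_eq[OF \<omega>'] \<gamma>_eq less_imp_le diff_ge_0_iff_ge simp_thms)
  qed
  also have "\<dots> = (\<integral>\<omega>'. (\<phi> \<circ> (\<lambda>\<omega>. \<lambda>i\<in>{1..l}. T i \<omega>)) \<omega>' \<partial>M) *
      (\<integral>\<omega>'. ((\<lambda>\<tau>. \<gamma> (\<Sum>i=l+1..k. \<tau> i)) \<circ> (\<lambda>\<omega>. \<lambda>i\<in>{l+1..k}. T i \<omega>)) \<omega>' \<partial>M)"
    by (rule indep_var_lebesgue_integral[OF indep])
      (intro integrable_const_bound[where B=1] rv always_eventually; simp add: bounded)+
  also have "(\<integral>\<omega>'. (\<phi> \<circ> (\<lambda>\<omega>. \<lambda>i\<in>{1..l}. T i \<omega>)) \<omega>' \<partial>M) =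
      \<P>(\<omega> in M. first_min l (\<lambda>t. J t \<omega>) (\<lambda>j. epoch T j \<omega>))"
    unfolding prob_sampled_event(2)[OF sampled_event_first_min]
    by (rule Bochner_Integration.integral_cong[OF refl]) (simp only: comp_def \<phi>_eq)
  also have "(\<integral>\<omega>'. ((\<lambda>\<tau>. \<gamma> (\<Sum>i=l+1..k. \<tau> i)) \<circ> (\<lambda>\<omega>. \<lambda>i\<in>{l+1..k}. T i \<omega>)) \<omega>' \<partial>M) =
      (\<integral>\<omega>'. \<gamma> (\<Sum>i\<in>{l+1..k}. T i \<omega>') \<partial>M)"
    by simp
  \<comment> \<open>Both index sets have \<open>k - l\<close> elements and are nonempty since
    \<open>l < k\<close>, so both sums have the same Erlang law.\<close>
  also have "\<dots> = (\<integral>\<omega>'. \<gamma> (\<Sum>i\<in>{1..k-l}. T i \<omega>') \<partial>M)"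
    using l by (subst (1 2) \<gamma>_sum) auto
  also have "\<dots> = (\<integral>\<omega>'. \<P>(\<omega> in M. running_min (\<lambda>t. J t \<omega>) (epoch T (k - l) \<omega>')) \<partial>M)"
    by (rule Bochner_Integration.integral_cong[OF refl])
      (simp only: epoch_def[symmetric] \<gamma>_eq epoch_nonneg)
  also have "\<dots> = \<P>(\<omega> in M. running_min (\<lambda>t. J t \<omega>) (epoch T (k - l) \<omega>))"
    by (rule prob_sampled_event(2)[OF sampled_event_running_min, symmetric])
  finally show ?thesis .
qed

section \<open>The renewal identity\<close>

lemma sampled_workload_0:
  assumes \<omega>: "\<omega> \<in> space M"
  shows "sampled_workload J V0 T 0 \<omega> = V0 \<omega>"
  using V0_nonneg[OF \<omega>] levy_start[OF \<omega>]
  by (simp add: sampled_workload_def workload_def epoch_def net_input_def regulator_def)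

text \<open>From an empty start the workload is the net input reflected at its running infimum, so
  it vanishes exactly when the infimum is attained at the current time.\<close>

lemma sampled_workload_eq_0_iff:
  assumes \<omega>: "\<omega> \<in> space M" and V0: "V0 \<omega> = 0"
  shows "sampled_workload J V0 T k \<omega> = 0 \<longleftrightarrow> running_min (\<lambda>t. J t \<omega>) (epoch T k \<omega>)"
proof -
  let ?X = "\<lambda>u. J u \<omega> - u" and ?t = "epoch T k \<omega>"
  have t: "0 \<le> ?t" using \<omega> by (rule epoch_nonneg)
  \<comment> \<open>Since \<open>J\<close> is nondecreasing from 0, the net input cannot fall below
    \<open>- ?t\<close>. This makes the real infimum a genuine lower bound.\<close>
  have "- ?t \<le> ?X u" if "u \<in> {0..?t}" for u
    using mono_onD[OF nondecreasing[OF \<omega>], of 0 u] levy_start[OF \<omega>] that by simp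
  then have bdd: "bdd_below (?X ` {0..?t})" by (rule bdd_belowI2)
  \<comment> \<open>The net input starts at 0, so the regulator is nonnegative and wins the maximum
    against \<open>V0 \<omega> = 0\<close>.\<close>
  have "(INF u\<in>{0..?t}. ?X u) \<le> 0"
    using cINF_lower[OF bdd, of 0] t levy_start[OF \<omega>] by simp
  then have "sampled_workload J V0 T k \<omega> = ?X ?t - (INF u\<in>{0..?t}. ?X u)"
    by (simp add: sampled_workload_def workload_def net_input_def regulator_def V0)
  moreover have "?X ?t = (INF u\<in>{0..?t}. ?X u) \<longleftrightarrow> (\<forall>u\<in>{0..?t}. ?X ?t \<le> ?X u)"
  proof
    assume "?X ?t = (INF u\<in>{0..?t}. ?X u)"
    then show "\<forall>u\<in>{0..?t}. ?X ?t \<le> ?X u" using cINF_lower[OF bdd] by simp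
  next
    assume "\<forall>u\<in>{0..?t}. ?X ?t \<le> ?X u"
    then have "?X ?t \<le> (INF u\<in>{0..?t}. ?X u)" using t by (intro cINF_greatest) auto
    moreover have "(INF u\<in>{0..?t}. ?X u) \<le> ?X ?t" using t by (intro cINF_lower[OF bdd]) auto
    ultimately show "?X ?t = (INF u\<in>{0..?t}. ?X u)" by (rule antisym)
  qed
  ultimately show ?thesis
    using running_min_iff[OF right_continuous_path[OF \<omega>] t] by simp
qed

lemma return_index_eq_iff:
  assumes \<omega>: "\<omega> \<in> space M" and V0: "V0 \<omega> = 0" and k: "1 \<le> k"
  shows "return_index J V0 T \<omega> = enat k \<longleftrightarrow> first_min k (\<lambda>t. J t \<omega>) (\<lambda>j. epoch T j \<omega>)"
proof -
  let ?A = "{j. 1 \<le> j \<and> running_min (\<lambda>t. J t \<omega>) (epoch T j \<omega>)}"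
  have R: "return_index J V0 T \<omega> = Inf (enat ` ?A)"
    by (simp add: return_index_def sampled_workload_eq_0_iff[OF \<omega> V0])
  have "Inf (enat ` ?A) = enat k \<longleftrightarrow> k \<in> ?A \<and> (\<forall>j\<in>?A. k \<le> j)"
  proof
    assume *: "Inf (enat ` ?A) = enat k"
    \<comment> \<open>The infimum of the empty set is \<infinity>, which is no
      \<open>enat k\<close>. Hence the set is nonempty, and its infimum is attained by
      well-ordering.\<close>
    have "enat ` ?A \<noteq> {}"
    proof
      assume "enat ` ?A = {}"
      with * show False by (simp only: Inf_enat_def simp_thms if_True infinity_ne_i0 enat.distinct)
    qed
    then have "Inf (enat ` ?A) \<in> enat ` ?A"
      unfolding Inf_enat_def by (simp only: if_False) (rule LeastI_ex, blast)
    moreover have "enat k \<le> enat j" if "j \<in> ?A" for j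
      unfolding *[symmetric] using that by (intro Inf_lower) auto
    ultimately show "k \<in> ?A \<and> (\<forall>j\<in>?A. k \<le> j)" using * by auto
  next
    assume "k \<in> ?A \<and> (\<forall>j\<in>?A. k \<le> j)"
    then show "Inf (enat ` ?A) = enat k"
      by (intro antisym Inf_lower Inf_greatest) auto
  qed
  also have "\<dots> \<longleftrightarrow> first_min k (\<lambda>t. J t \<omega>) (\<lambda>j. epoch T j \<omega>)"
    using k by (auto simp: first_min_def not_less[symmetric])
  finally show ?thesis unfolding R .
qed

text \<open>The path and the epochs are jointly independent of \<open>V0\<close>, so the probability
  of an empty start cancels. \<open>P\<close> has to match \<open>G\<close> only on the outcomes
  with an empty start.\<close>

lemma cond_prob_empty_start:
  assumes G: "sampled_event G" and V0: "\<P>(\<omega> in M. V0 \<omega> = 0) \<noteq> 0"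
    and P: "\<And>\<omega>. \<omega> \<in> space M \<Longrightarrow> V0 \<omega> = 0 \<Longrightarrow> P \<omega> \<longleftrightarrow> G (\<lambda>t. J t \<omega>) (\<lambda>j. epoch T j \<omega>)"
  shows "\<P>(\<omega> in M. P \<omega> \<bar> sampled_workload J V0 T 0 \<omega> = 0) =
    \<P>(\<omega> in M. G (\<lambda>t. J t \<omega>) (\<lambda>j. epoch T j \<omega>))"
proof -
  have "{\<omega> \<in> space M. P \<omega> \<and> sampled_workload J V0 T 0 \<omega> = 0} =
      {\<omega> \<in> space M. V0 \<omega> = 0 \<and> G (\<lambda>t. J t \<omega>) (\<lambda>j. epoch T j \<omega>)}"
    using P sampled_workload_0 by auto
  moreover have "{\<omega> \<in> space M. sampled_workload J V0 T 0 \<omega> = 0} = {\<omega> \<in> space M. V0 \<omega> = 0}"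
    using sampled_workload_0 by auto
  ultimately show ?thesis
    using V0 by (simp add: cond_prob_def prob_sampled_event(3)[OF G])
qed

lemma return_prob_renewal:
  assumes k: "1 \<le> k"
  shows "return_prob M J V0 T k =
    empty_prob M J V0 T k - (\<Sum>l=1..<k. return_prob M J V0 T l * empty_prob M J V0 T (k - l))"
proof (cases "\<P>(\<omega> in M. V0 \<omega> = 0) = 0")
  \<comment> \<open>If an empty start has probability 0, each conditional probability is a division
    by zero with value 0, and the identity reads 0 = 0.\<close>
  case True
  have "{\<omega> \<in> space M. sampled_workload J V0 T 0 \<omega> = 0} = {\<omega> \<in> space M. V0 \<omega> = 0}"
    using sampled_workload_0 by auto
  with True show ?thesis
    by (simp add: return_prob_def empty_prob_def cond_prob_def)
next
  case False
  let ?F = "\<lambda>l \<omega>. first_min l (\<lambda>t. J t \<omega>) (\<lambda>j. epoch T j \<omega>)"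
  let ?E = "\<lambda>j \<omega>. running_min (\<lambda>t. J t \<omega>) (epoch T j \<omega>)"
  have empty: "empty_prob M J V0 T j = \<P>(\<omega> in M. ?E j \<omega>)" for j
    unfolding empty_prob_def
    by (rule cond_prob_empty_start[OF sampled_event_running_min False sampled_workload_eq_0_iff])
  have return: "return_prob M J V0 T l = \<P>(\<omega> in M. ?F l \<omega>)" if "1 \<le> l" for l
    unfolding return_prob_def
    by (rule cond_prob_empty_start[OF sampled_event_first_min False return_index_eq_iff])
      (use that in simp_all)
  \<comment> \<open>The event of an empty queue at \<open>k\<close> is partitioned by the index of
    the first empty epoch, which is at most \<open>k\<close>.\<close>
  have "\<P>(\<omega> in M. ?E k \<omega>) = (\<Sum>l\<in>{1..k}. \<P>(\<omega> in M. ?F l \<omega> \<and> ?E k \<omega>))"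
  proof (rule prob_sum)
    show "{\<omega> \<in> space M. ?F l \<omega> \<and> ?E k \<omega>} \<in> events" for l
      by (rule prob_sampled_event(1)[OF sampled_event_conj[OF sampled_event_first_min sampled_event_running_min]])
    show "{\<omega> \<in> space M. ?E k \<omega>} \<in> events"
      by (rule prob_sampled_event(1)[OF sampled_event_running_min])
    have "\<exists>!l. l \<in> {1..k} \<and> ?F l \<omega> \<and> ?E k \<omega>" if "?E k \<omega>" for \<omega>
      using ex1_first_min[of "\<lambda>t. J t \<omega>" "\<lambda>j. epoch T j \<omega>" k] that k by simp
    then show "AE \<omega> in M. (\<forall>l\<in>{1..k}. ?F l \<omega> \<and> ?E k \<omega> \<longrightarrow> ?E k \<omega>) \<and> (?E k \<omega> \<longrightarrow> (\<exists>!l\<in>{1..k}. ?F l \<omega> \<and> ?E k \<omega>))"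
      by (intro AE_I2) blast
  qed simp
  also have "{1..k} = insert k {1..<k}" using k by auto
  also have "(\<Sum>l\<in>insert k {1..<k}. \<P>(\<omega> in M. ?F l \<omega> \<and> ?E k \<omega>)) =
      \<P>(\<omega> in M. ?F k \<omega> \<and> ?E k \<omega>) + (\<Sum>l=1..<k. \<P>(\<omega> in M. ?F l \<omega> \<and> ?E k \<omega>))"
    by simp
  \<comment> \<open>A first return at \<open>k\<close> already includes emptiness at
    \<open>k\<close>, so this summand is the return probability itself; the renewal factorization is
    applied to \<open>l < k\<close> only.\<close>
  also have "\<P>(\<omega> in M. ?F k \<omega> \<and> ?E k \<omega>) = return_prob M J V0 T k"
    unfolding return[OF k] by (intro arg_cong[where f=prob]) (auto simp: first_min_def)
  also have "(\<Sum>l=1..<k. \<P>(\<omega> in M. ?F l \<omega> \<and> ?E k \<omega>)) =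
      (\<Sum>l=1..<k. return_prob M J V0 T l * empty_prob M J V0 T (k - l))"
    by (intro sum.cong refl) (simp add: prob_first_min_and_running_min return empty)
  finally show ?thesis by (simp add: empty)
qed

end

theorem lemma4:
  fixes M :: "'a measure" and J :: "real \<Rightarrow> 'a \<Rightarrow> real" and \<nu> :: "real measure"
    and V0 :: "'a \<Rightarrow> real" and T :: "nat \<Rightarrow> 'a \<Rightarrow> real" and \<xi> :: real and k :: nat
  assumes "poisson_sampled_queue M J \<nu> V0 T \<xi>"
    and "1 \<le> k"
  shows "return_prob M J V0 T k =
    empty_prob M J V0 T k - (\<Sum>l=1..<k. return_prob M J V0 T l * empty_prob M J V0 T (k - l))"
  using assms by (rule poisson_sampled_queue.return_prob_renewal)

end
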